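(* Let $N\ge 1$ be an integer, let $\theta,\ell\in\mathbb{R}$, and set $N':=N+\theta$ and $\tau:=\ell-\theta$. Assume $N'>2$ and $\tau>-2$, and let $p_s:=\frac{N'+2+2\tau}{N'-2}$. If $0<p\le p_s$, then the only nonnegative solution $u$ of $$-\mathrm{div}(|x|^\theta\nabla u)=|x|^\ell u^p\ \text{ in } \mathbb{R}^N\setminus\overline{B},\qquad u=0\ \text{ on } \partial B,$$ is $u\equiv 0$.
   Context: $B=\{x\in\mathbb{R}^N: |x|<1\}$ is the open unit ball of $\mathbb{R}^N$. Solutions are classical: $u\in C^2(\mathbb{R}^N\setminus B)$ ($C^2$ up to the boundary $\partial B$). No symmetry and no behavior at infinity is assumed of $u$. *)

theory Defs
  imports "HOL-Analysis.Analysis"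
begin

definition partial_derivative :: "'n::finite \<Rightarrow> (real^'n \<Rightarrow> real) \<Rightarrow> real^'n \<Rightarrow> real" where
  "partial_derivative i f x = frechet_derivative f (at x) (axis i 1)"

definition gradient :: "(real^'n::finite \<Rightarrow> real) \<Rightarrow> real^'n \<Rightarrow> real^'n" where
  "gradient f x = (\<chi> i. partial_derivative i f x)"

definition divergence :: "(real^'n::finite \<Rightarrow> real^'n) \<Rightarrow> real^'n \<Rightarrow> real" where
  "divergence F x = (\<Sum>i\<in>UNIV. partial_derivative i (\<lambda>y. F y $ i) x)"

definition C1_on :: "(real^'n::finite) set \<Rightarrow> (real^'n \<Rightarrow> real) \<Rightarrow> bool" where
  "C1_on U f \<longleftrightarrow> (\<forall>x\<in>U. f differentiable (at x)) \<and>
     (\<forall>i. continuous_on U (partial_derivative i f))"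

definition C2_on :: "(real^'n::finite) set \<Rightarrow> (real^'n \<Rightarrow> real) \<Rightarrow> bool" where
  "C2_on U f \<longleftrightarrow> C1_on U f \<and> (\<forall>i. C1_on U (partial_derivative i f))"

definition extends_continuously :: "(real^'n::finite) set \<Rightarrow> (real^'n \<Rightarrow> real) \<Rightarrow> bool" where
  "extends_continuously U f \<longleftrightarrow>
     (\<exists>g. continuous_on (closure U) g \<and> (\<forall>x\<in>U. g x = f x))"

(* The class C^2 up to the boundary of an open set U.  The function f itself is
   continuous on the closure, so its boundary values are those of its continuous
   extension; the derivatives are only taken inside U, so that the values of f outside
   the closure play no role. *)
definition C2_on_closure :: "(real^'n::finite) set \<Rightarrow> (real^'n \<Rightarrow> real) \<Rightarrow> bool" where
  "C2_on_closure U f \<longleftrightarrow> C2_on U f \<and> continuous_on (closure U) f \<and>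
     (\<forall>i. extends_continuously U (partial_derivative i f)) \<and>
     (\<forall>i j. extends_continuously U (partial_derivative j (partial_derivative i f)))"

lemma closure_exterior_unit_ball:
  "closure (- cball (0::real^'n::finite) 1) = - ball 0 1"
  by (simp add: closure_complement)

end

theory Submission
  imports Defs
begin

text \<open>
Put \<open>c = (N' - 2) / 2\<close> and \<open>w t x = exp (c * t) * u (exp t * x)\<close> for \<open>norm x = 1\<close>, \<open>t \<ge> 0\<close>. The
equation becomes \<open>w\<^sub>t\<^sub>t + S w - c\<^sup>2 w + exp (\<alpha> t) w powr p = 0\<close> on a half-cylinder, where \<open>S\<close> is the
Laplacian of the sphere, \<open>\<alpha> = c (p_s - p) \<ge> 0\<close> and \<open>\<alpha> + c (p - 1) = 2 + \<tau> > 0\<close>. The cross-section is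
compact, so every step is a comparison at a minimum point, and nothing has to be known at infinity.

A positive \<open>w\<close> touched from below by a multiple of a sine on an interval of length \<open>L\<close> has a point
with \<open>exp (\<alpha> t) w powr (p - 1) \<le> c\<^sup>2 + (pi / L)\<^sup>2\<close>. If \<open>p \<le> 1\<close>, this makes \<open>w\<close> grow faster than the bound
\<open>O(exp (c t))\<close> for its spherical minimum allows. If \<open>p > 1\<close>, moving planes started at \<open>t = 0\<close> (inversions
in spheres centred at the origin) compare \<open>w\<close> at \<open>2 \<lambda> - t\<close> and \<open>t\<close>, and yield \<open>w\<^sub>t > 0\<close>; hence \<open>w\<close> is bounded
below, which is absurd for \<open>\<alpha> > 0\<close>. If \<open>\<alpha> = 0\<close>, the logarithmic derivative \<open>h = w\<^sub>t / w > 0\<close> satisfies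
\<open>\<Delta> h + 2 \<nabla>(ln w) \<cdot> \<nabla> h + \<kappa> h \<le> 0\<close> with \<open>\<kappa> > 0\<close> and is small somewhere, which contradicts the comparison of \<open>h\<close>
with a multiple of a sine; as \<open>w\<close> is only \<open>C\<^sup>2\<close>, the difference quotient replaces \<open>w\<^sub>t\<close>.
\<close>

section \<open>Positive solutions on a half-cylinder\<close>

text \<open>Were \<open>D\<close> negative, \<open>f'\<close> would be negative just to the right of
  \<open>t0\<close>, and the mean value theorem would push \<open>f\<close> below its
  minimum.\<close>

lemma derivatives_at_interior_min:
  fixes f f' :: "real \<Rightarrow> real"
  assumes t0: "a < t0" "t0 < b"
    and min: "\<And>t. a < t \<Longrightarrow> t < b \<Longrightarrow> f t0 \<le> f t"
    and f': "\<And>t. a < t \<Longrightarrow> t < b \<Longrightarrow> (f has_real_derivative f' t) (at t)"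
    and f'': "(f' has_real_derivative D) (at t0)"
  shows "f' t0 = 0" "D \<ge> 0"
proof -
  define d where "d = min (t0 - a) (b - t0)"
  have d: "d > 0" "\<And>t. \<bar>t0 - t\<bar> < d \<Longrightarrow> a < t \<and> t < b"
    using t0 by (auto simp: d_def)
  show z: "f' t0 = 0"
    using DERIV_local_min[OF f'[OF t0] d(1)] min d(2) by blast
  show "D \<ge> 0"
  proof (rule ccontr)
    assume "\<not> D \<ge> 0"
    obtain e where e: "e > 0" "\<And>h. h > 0 \<Longrightarrow> h < e \<Longrightarrow> f' (t0 + h) < f' t0"
      using DERIV_neg_dec_right[OF f''] \<open>\<not> D \<ge> 0\<close> by auto
    define h where "h = min e d / 2"
    have h: "h > 0" "h < e" "h < d"
      using e(1) d(1) by (auto simp: h_def)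
    have "\<exists>z>t0. z < t0 + h \<and> f (t0 + h) - f t0 = (t0 + h - t0) * f' z"
      using h(1,3) d(2) by (intro MVT2) (auto intro!: f')
    then obtain z where z': "t0 < z" "z < t0 + h" "f (t0 + h) - f t0 = h * f' z"
      by auto
    have "f' z < 0"
      using e(2)[of "z - t0"] z' h z by auto
    then have "f (t0 + h) < f t0"
      using z'(3) h(1) mult_pos_neg[of h "f' z"] by linarith
    moreover have "f t0 \<le> f (t0 + h)"
      using h(1,3) d(2)[of "t0 + h"] by (intro min) auto
    ultimately show False by simp
  qed
qed

text \<open>Convexity: the power lies above its tangent \<open>1 + p * (R - 1)\<close> at
  \<open>1\<close>. It bounds the nonlinearity from below in the critical case.\<close>

lemma powr_ge_tangent_at_1:
  fixes R p :: real
  assumes "R \<ge> 1" "p \<ge> 1"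
  shows "R powr p - R \<ge> (p - 1) * (R - 1)"
proof (cases "R = 1")
  case False
  have "\<exists>z>1. z < R \<and> R powr p - 1 powr p = (R - 1) * (p * z powr (p - 1))"
    using assms False by (intro MVT2) (auto intro!: derivative_eq_intros)
  then obtain z where z: "z > 1" "R powr p - 1 = (R - 1) * (p * z powr (p - 1))" by auto
  have "z powr (p - 1) \<ge> 1" using z assms by (simp add: ge_one_powr_ge_zero)
  then have "(R - 1) * p * 1 \<le> (R - 1) * p * z powr (p - 1)"
    using assms by (intro mult_left_mono) auto
  then show ?thesis using z by (simp add: algebra_simps)
qed simp

text \<open>Mean value theorem; since \<open>p \<ge> 1\<close>, the derivative of the power is at
  most its value at \<open>M\<close>. This is the Lipschitz bound used on narrow strips.\<close>

lemma powr_diff_le: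
  fixes x y M p :: real
  assumes "0 < x" "x \<le> y" "y \<le> M" "p \<ge> 1"
  shows "y powr p - x powr p \<le> p * M powr (p - 1) * (y - x)"
proof (cases "x = y")
  case False
  have "\<exists>z>x. z < y \<and> y powr p - x powr p = (y - x) * (p * z powr (p - 1))"
    using assms False by (intro MVT2) (auto intro!: derivative_eq_intros)
  then obtain z where z: "z > x" "z < y" "y powr p - x powr p = (y - x) * (p * z powr (p - 1))" by auto
  have "z powr (p - 1) \<le> M powr (p - 1)" using z assms by (intro powr_mono2) auto
  then have "(y - x) * p * z powr (p - 1) \<le> (y - x) * p * M powr (p - 1)"
    using assms by (intro mult_left_mono) auto
  then show ?thesis using z by (simp add: algebra_simps)
qed simp

lemma exp_unbounded:
  fixes B r Q A :: real
  assumes "B > 0" "r > 0"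
  obtains a where "a \<ge> A" "Q < B * exp (r * a)"
proof -
  \<comment> \<open>This \<open>a\<close> gives \<open>B * (r * a) \<ge> Q\<close>, and
    \<open>exp z > z\<close> makes the inequality strict.\<close>
  define a where "a = max A (Q / (B * r))"
  have "Q / (B * r) \<le> a" by (simp add: a_def)
  then have "Q \<le> B * (r * a)" using assms by (simp add: field_simps)
  also have "\<dots> < B * exp (r * a)" using assms exp_gt_self[of "r * a"] by simp
  finally show ?thesis using that[of a] by (auto simp: a_def)
qed

text \<open>\<open>S\<close> stands for the spherical Laplacian of \<open>w\<close>. All that is needed of it is \<open>S_min\<close>: it is linear and
nonnegative at a minimum over the cross-section.\<close>

locale half_cylinder =
  fixes K :: "'a::metric_space set" and w w1 w2 S :: "real \<Rightarrow> 'a \<Rightarrow> real" and c \<alpha> p :: real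
  assumes K: "compact K" "K \<noteq> {}"
    and c: "c > 0" and \<alpha>: "\<alpha> \<ge> 0" and p: "p > 0" and subcritical: "\<alpha> + c * (p - 1) > 0"
    and cont: "continuous_on ({0..} \<times> K) (\<lambda>(t, x). w t x)"
    and zero: "x \<in> K \<Longrightarrow> w 0 x = 0"
    and pos: "t > 0 \<Longrightarrow> x \<in> K \<Longrightarrow> w t x > 0"
    and w1: "t > 0 \<Longrightarrow> x \<in> K \<Longrightarrow> ((\<lambda>t. w t x) has_real_derivative w1 t x) (at t)"
    and w2: "t > 0 \<Longrightarrow> x \<in> K \<Longrightarrow> ((\<lambda>t. w1 t x) has_real_derivative w2 t x) (at t)"
    and cont1: "continuous_on ({0<..} \<times> K) (\<lambda>(t, x). w1 t x)"
    and eq: "t > 0 \<Longrightarrow> x \<in> K \<Longrightarrow> w2 t x + S t x = c\<^sup>2 * w t x - exp (\<alpha> * t) * w t x powr p"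
    and S_min: "t > 0 \<Longrightarrow> t' > 0 \<Longrightarrow> x0 \<in> K \<Longrightarrow>
      (\<And>x. x \<in> K \<Longrightarrow> w t' x0 - b * w t x0 \<le> w t' x - b * w t x) \<Longrightarrow> 0 \<le> S t' x0 - b * S t x0"
begin

text \<open>One second-order test serves all comparisons: \<open>e = 1\<close> covers barriers and translates in \<open>t\<close>,
\<open>e = -1\<close> covers the reflections of the moving plane method.\<close>

lemma touch:
  assumes x0: "x0 \<in> K" and t0: "a < t0" "t0 < b" and e: "e = 1 \<or> e = -1"
    and dom: "\<And>t. a < t \<Longrightarrow> t < b \<Longrightarrow> 0 < t \<and> 0 < e * t + k"
    and g: "\<And>t. (g has_real_derivative g1 t) (at t)" "(g1 has_real_derivative g2) (at t0)"
    and \<phi>: "\<And>t. (\<phi> has_real_derivative \<phi>1 t) (at t)" "(\<phi>1 has_real_derivative \<phi>2) (at t0)"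
    and min: "\<And>t x. a < t \<Longrightarrow> t < b \<Longrightarrow> x \<in> K \<Longrightarrow>
      w (e * t0 + k) x0 - g t0 * w t0 x0 - \<phi> t0 \<le> w (e * t + k) x - g t * w t x - \<phi> t"
  shows "0 \<le> c\<^sup>2 * (w (e * t0 + k) x0 - g t0 * w t0 x0)
    - (exp (\<alpha> * (e * t0 + k)) * w (e * t0 + k) x0 powr p - g t0 * (exp (\<alpha> * t0) * w t0 x0 powr p))
    - g2 * w t0 x0 - 2 * g1 t0 * w1 t0 x0 - \<phi>2"
proof -
  have d: "0 < t0" "0 < e * t0 + k" using dom t0 by auto
  \<comment> \<open>With \<open>t\<close> frozen at \<open>t0\<close>, the minimality is one over
    the cross-section, where \<open>\<phi> t0\<close> is a constant and drops out.\<close>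
  have "0 \<le> S (e * t0 + k) x0 - g t0 * S t0 x0"
    using min[OF t0] d x0 by (intro S_min) (auto simp: algebra_simps)
  moreover have "0 \<le> w2 (e * t0 + k) x0 - (g2 * w t0 x0 + 2 * (g1 t0 * w1 t0 x0) + g t0 * w2 t0 x0) - \<phi>2"
  proof (rule derivatives_at_interior_min(2)[OF t0, where f' =
      "\<lambda>t. e * w1 (e * t + k) x0 - (g1 t * w t x0 + g t * w1 t x0) - \<phi>1 t"])
    fix t assume t: "a < t" "t < b"
    show "w (e * t0 + k) x0 - g t0 * w t0 x0 - \<phi> t0 \<le> w (e * t + k) x0 - g t * w t x0 - \<phi> t"
      by (rule min[OF t x0])
    have "((\<lambda>t. w (e * t + k) x0) has_real_derivative w1 (e * t + k) x0 * e) (at t)"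
      using dom[OF t] by (intro DERIV_chain2[OF w1[OF _ x0]]) (auto intro!: derivative_eq_intros)
    then show "((\<lambda>t. w (e * t + k) x0 - g t * w t x0 - \<phi> t) has_real_derivative
        e * w1 (e * t + k) x0 - (g1 t * w t x0 + g t * w1 t x0) - \<phi>1 t) (at t)"
      using dom[OF t] by (auto intro!: derivative_eq_intros g \<phi> w1[OF _ x0])
  next
    have "((\<lambda>t. w1 (e * t + k) x0) has_real_derivative w2 (e * t0 + k) x0 * e) (at t0)"
      using d by (intro DERIV_chain2[OF w2[OF _ x0]]) (auto intro!: derivative_eq_intros)
    \<comment> \<open>As \<open>e * e = 1\<close>, the two signs produced by a reflection cancel in
      the second derivative.\<close>
    then have w1': "((\<lambda>t. e * w1 (e * t + k) x0) has_real_derivative w2 (e * t0 + k) x0) (at t0)"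
      using e DERIV_cmult[of "\<lambda>t. w1 (e * t + k) x0" "w2 (e * t0 + k) x0 * e" t0 UNIV e] by auto
    show "((\<lambda>t. e * w1 (e * t + k) x0 - (g1 t * w t x0 + g t * w1 t x0) - \<phi>1 t) has_real_derivative
       w2 (e * t0 + k) x0 - (g2 * w t0 x0 + 2 * (g1 t0 * w1 t0 x0) + g t0 * w2 t0 x0) - \<phi>2) (at t0)"
      by (rule w1' derivative_eq_intros g \<phi> w1[OF d(1) x0] w2[OF d(1) x0] refl | assumption)+ (simp add: algebra_simps)
  qed
  \<comment> \<open>The equation at \<open>t0\<close> is weighted by \<open>g t0\<close>, so that
    together with the one at \<open>e * t0 + k\<close> it eliminates \<open>w2\<close> and
    \<open>S\<close>.\<close>
  moreover have "g t0 * (w2 t0 x0 + S t0 x0) = g t0 * (c\<^sup>2 * w t0 x0 - exp (\<alpha> * t0) * w t0 x0 powr p)"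
    using eq[OF d(1) x0] by simp
  ultimately show ?thesis
    using eq[OF d(2) x0] by (simp add: algebra_simps)
qed

section \<open>Continuity and extrema on compact pieces of the cylinder\<close>

lemma cont_w:
  assumes "continuous_on A f" "continuous_on A h" "\<And>z. z \<in> A \<Longrightarrow> f z \<ge> 0" "\<And>z. z \<in> A \<Longrightarrow> h z \<in> K"
  shows "continuous_on A (\<lambda>z. w (f z) (h z))"
proof -
  have "continuous_on A (\<lambda>z. (\<lambda>(t, x). w t x) (f z, h z))"
    using assms by (intro continuous_on_compose2[OF cont] continuous_intros) auto
  then show ?thesis by simp
qed

lemma cont_w1:
  assumes "continuous_on A f" "continuous_on A h" "\<And>z. z \<in> A \<Longrightarrow> f z > 0" "\<And>z. z \<in> A \<Longrightarrow> h z \<in> K"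
  shows "continuous_on A (\<lambda>z. w1 (f z) (h z))"
proof -
  have "continuous_on A (\<lambda>z. (\<lambda>(t, x). w1 t x) (f z, h z))"
    using assms by (intro continuous_on_compose2[OF cont1] continuous_intros) auto
  then show ?thesis by simp
qed

lemma attains_inf:
  fixes f :: "real \<Rightarrow> 'a \<Rightarrow> real"
  assumes "a \<le> b" "continuous_on ({a..b} \<times> K) (\<lambda>z. f (fst z) (snd z))"
  obtains t0 x0 where "a \<le> t0" "t0 \<le> b" "x0 \<in> K" "\<And>t x. a \<le> t \<Longrightarrow> t \<le> b \<Longrightarrow> x \<in> K \<Longrightarrow> f t0 x0 \<le> f t x"
proof -
  have "\<exists>z\<in>{a..b} \<times> K. \<forall>y\<in>{a..b} \<times> K. f (fst z) (snd z) \<le> f (fst y) (snd y)"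
    using assms K by (intro continuous_attains_inf compact_Times) auto
  then show ?thesis using that by (auto simp: Ball_def)
qed

lemma w_nonneg: "t \<ge> 0 \<Longrightarrow> x \<in> K \<Longrightarrow> w t x \<ge> 0"
  using zero pos[of t x] by (cases "t = 0") (auto intro: less_imp_le)

lemma slice_attains_inf:
  assumes "t \<ge> 0"
  obtains x0 where "x0 \<in> K" "\<And>x. x \<in> K \<Longrightarrow> w t x0 \<le> w t x"
proof (rule attains_inf[of t t w])
  show "continuous_on ({t..t} \<times> K) (\<lambda>z. w (fst z) (snd z))"
    using assms by (intro cont_w continuous_intros) auto
  fix t0 x0 assume "t \<le> t0" "t0 \<le> t" "x0 \<in> K" "\<And>t' x. t \<le> t' \<Longrightarrow> t' \<le> t \<Longrightarrow> x \<in> K \<Longrightarrow> w t0 x0 \<le> w t' x"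
  then show thesis using that[of x0] by auto
qed auto

section \<open>Barriers depending on \<open>t\<close> alone\<close>

text \<open>The largest multiple \<open>s\<close> of the sine arch on \<open>[a, b]\<close> that
  stays below \<open>w\<close> touches it at an interior point, because the arch vanishes at both
  ends. The second-order test there gives the last bound. The arch has maximum 1, attained at the
  midpoint, whence the two inequalities between \<open>s\<close> and \<open>w\<close>.\<close>

lemma sine_barrier:
  assumes "0 < a" "a < b"
  obtains s t0 x0 where "a < t0" "t0 < b" "x0 \<in> K" "s > 0"
    "\<And>x. x \<in> K \<Longrightarrow> w ((a + b) / 2) x \<ge> s" "w t0 x0 \<le> s"
    "exp (\<alpha> * t0) * w t0 x0 powr (p - 1) \<le> c\<^sup>2 + (pi / (b - a))\<^sup>2"
proof -
  define \<nu> where "\<nu> = pi / (b - a)"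
  define \<psi> where "\<psi> t = sin (\<nu> * (t - a))" for t
  have \<nu>: "\<nu> > 0" "\<nu> * (b - a) = pi" using assms by (auto simp: \<nu>_def)
  have "\<nu> * ((a + b) / 2 - a) = pi / 2" using \<nu>(2) by (simp add: field_simps)
  then have mid: "\<psi> ((a + b) / 2) = 1" by (simp add: \<psi>_def)
  have ends: "\<psi> a = 0" "\<psi> b = 0" using \<nu> by (auto simp: \<psi>_def)
  \<comment> \<open>The quotient \<open>\<psi> / w\<close> is maximised; the sign turns this into a
    minimum. The maximal value is \<open>1 / s\<close>.\<close>
  obtain t0 x0 where t0: "a \<le> t0" "t0 \<le> b" "x0 \<in> K"
    and inf: "\<And>t x. a \<le> t \<Longrightarrow> t \<le> b \<Longrightarrow> x \<in> K \<Longrightarrow> - \<psi> t0 / w t0 x0 \<le> - \<psi> t / w t x"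
  proof (rule attains_inf[of a b "\<lambda>t x. - \<psi> t / w t x"])
    show "continuous_on ({a..b} \<times> K) (\<lambda>z. - \<psi> (fst z) / w (fst z) (snd z))"
      unfolding \<psi>_def using assms
      by (intro continuous_intros cont_w ballI less_imp_neq[symmetric] pos) auto
  qed (use assms in auto)
  obtain x1 where x1: "x1 \<in> K" using K by auto
  have wpos: "w t x > 0" if "a \<le> t" "x \<in> K" for t x using pos assms that by auto
  define s where "s = w t0 x0 / \<psi> t0"
  have "\<psi> t0 / w t0 x0 \<ge> 1 / w ((a + b) / 2) x1"
    using inf[of "(a + b) / 2" x1] x1 mid assms by auto
  moreover have "1 / w ((a + b) / 2) x1 > 0" using wpos x1 assms by auto
  ultimately have "\<psi> t0 / w t0 x0 > 0" by linarith
  then have \<psi>0: "\<psi> t0 > 0" using wpos[OF t0(1,3)] by (simp add: zero_less_divide_iff)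
  then have t0': "a < t0" "t0 < b" using ends t0 by (auto simp: less_le)
  have s: "s > 0" using \<psi>0 wpos[OF t0(1,3)] by (simp add: s_def)
  have le: "s * \<psi> t \<le> w t x" if "a \<le> t" "t \<le> b" "x \<in> K" for t x
    using inf[OF that] wpos[OF that(1,3)] wpos[OF t0(1,3)] \<psi>0 by (simp add: s_def field_simps)
  have e0: "s * \<psi> t0 = w t0 x0" using \<psi>0 by (simp add: s_def)
  have "0 \<le> c\<^sup>2 * (w (1 * t0 + 0) x0 - 0 * w t0 x0)
    - (exp (\<alpha> * (1 * t0 + 0)) * w (1 * t0 + 0) x0 powr p - 0 * (exp (\<alpha> * t0) * w t0 x0 powr p))
    - 0 * w t0 x0 - 2 * 0 * w1 t0 x0 - (- s * \<nu> * \<nu> * \<psi> t0)"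
  proof (rule touch[OF t0(3) t0', where g = "\<lambda>_. 0" and ?g1.0 = "\<lambda>_. 0"
      and \<phi> = "\<lambda>t. s * \<psi> t" and ?\<phi>1.0 = "\<lambda>t. s * \<nu> * cos (\<nu> * (t - a))"])
    fix t x assume "a < t" "t < b" "x \<in> K"
    then show "w (1 * t0 + 0) x0 - 0 * w t0 x0 - s * \<psi> t0 \<le> w (1 * t + 0) x - 0 * w t x - s * \<psi> t"
      using le[of t x] e0 by simp
  qed (use assms in \<open>auto simp: \<psi>_def intro!: derivative_eq_intros\<close>)
  then have "exp (\<alpha> * t0) * w t0 x0 powr p \<le> (c\<^sup>2 + \<nu>\<^sup>2) * w t0 x0"
    using e0[symmetric] by (simp add: algebra_simps power2_eq_square)
  moreover have "w t0 x0 powr p = w t0 x0 powr (p - 1) * w t0 x0"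
    using wpos[OF t0(1,3)] by (simp add: powr_diff)
  ultimately have "exp (\<alpha> * t0) * w t0 x0 powr (p - 1) \<le> c\<^sup>2 + \<nu>\<^sup>2"
    using wpos[OF t0(1,3)] by (simp flip: mult.assoc)
  moreover have "w t0 x0 \<le> s"
    using e0 s mult_left_le[of "\<psi> t0" s] by (simp add: \<psi>_def)
  moreover have "w ((a + b) / 2) x \<ge> s" if "x \<in> K" for x
    using le[of "(a + b) / 2" x] that mid assms by auto
  ultimately show ?thesis using that t0' t0(3) s \<nu>_def by blast
qed

text \<open>The function \<open>sinh (c * t)\<close> solves
  \<open>\<phi>'' = c\<^sup>2 \<phi>\<close>, and \<open>w\<close> is a supersolution of the
  corresponding linear equation, so \<open>w - \<phi>\<close> has no negative interior minimum. Read
  at a fixed \<open>t\<close>, this bounds the minimum of \<open>w\<close> over the slice at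
  \<open>T\<close> by \<open>O(exp (c * T))\<close>.\<close>

lemma sinh_comparison:
  assumes "T > 0" "0 \<le> t" "t \<le> T" "x \<in> K" and s: "s \<ge> 0" "\<And>x. x \<in> K \<Longrightarrow> s \<le> w T x"
  shows "s * sinh (c * t) / sinh (c * T) \<le> w t x"
proof (rule ccontr)
  assume neg: "\<not> ?thesis"
  define A where "A = s / sinh (c * T)"
  define \<phi> where "\<phi> = (\<lambda>t. A * sinh (c * t))"
  have sT: "sinh (c * T) \<noteq> 0" using assms c by simp
  then have \<phi>T: "\<phi> T = s" unfolding \<phi>_def A_def by (rule nonzero_eq_divide_eq[THEN iffD1, OF _ refl])
  obtain t0 x0 where t0: "0 \<le> t0" "t0 \<le> T" "x0 \<in> K"
    and inf: "\<And>t x. 0 \<le> t \<Longrightarrow> t \<le> T \<Longrightarrow> x \<in> K \<Longrightarrow> w t0 x0 - \<phi> t0 \<le> w t x - \<phi> t"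
  proof (rule attains_inf[of 0 T "\<lambda>t x. w t x - \<phi> t"])
    show "continuous_on ({0..T} \<times> K) (\<lambda>z. w (fst z) (snd z) - \<phi> (fst z))"
      unfolding \<phi>_def using assms by (intro continuous_intros cont_w) auto
  qed (use assms in auto)
  have n0: "w t0 x0 < \<phi> t0" using inf[of t x] neg assms by (auto simp: \<phi>_def A_def)
  have "t0 \<noteq> 0" "t0 \<noteq> T" using n0 zero[OF t0(3)] s(2)[OF t0(3)] \<phi>T by (auto simp: \<phi>_def)
  then have t0': "0 < t0" "t0 < T" using t0 by auto
  have "0 \<le> c\<^sup>2 * (w (1 * t0 + 0) x0 - 0 * w t0 x0)
    - (exp (\<alpha> * (1 * t0 + 0)) * w (1 * t0 + 0) x0 powr p - 0 * (exp (\<alpha> * t0) * w t0 x0 powr p))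
    - 0 * w t0 x0 - 2 * 0 * w1 t0 x0 - (c * c * \<phi> t0)"
  proof (rule touch[OF t0(3) t0', where g = "\<lambda>_. 0" and ?g1.0 = "\<lambda>_. 0"
      and \<phi> = "\<phi>" and ?\<phi>1.0 = "\<lambda>t. A * c * cosh (c * t)"])
    fix t x assume "0 < t" "t < T" "x \<in> K"
    then show "w (1 * t0 + 0) x0 - 0 * w t0 x0 - \<phi> t0 \<le> w (1 * t + 0) x - 0 * w t x - \<phi> t"
      using inf[of t x] by simp
  next
    show "(\<phi> has_real_derivative A * c * cosh (c * t)) (at t)" for t
      unfolding \<phi>_def by (auto intro!: derivative_eq_intros)
    show "((\<lambda>t. A * c * cosh (c * t)) has_real_derivative c * c * \<phi> t0) (at t0)"
      unfolding \<phi>_def by (auto intro!: derivative_eq_intros)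
  qed auto
  then have "exp (\<alpha> * t0) * w t0 x0 powr p \<le> c * c * (w t0 x0 - \<phi> t0)"
    by (simp add: algebra_simps power2_eq_square)
  also have "\<dots> < 0" using n0 c by (intro mult_pos_neg) auto
  finally show False by (simp add: not_less[symmetric] mult_less_0_iff)
qed

section \<open>Moving planes and monotonicity in \<open>t\<close>\<close>

text \<open>Where the reflection dominates, the nonlinear terms of the difference have a favourable
  sign because \<open>\<alpha> \<ge> 0\<close> and \<open>p > 0\<close>, so the difference is a
  supersolution of the linear equation. The comparison function vanishes at the plane and equals
  \<open>\<eta>\<close> at \<open>t = 0\<close>, where the difference is
  \<open>w (2 * lam) x\<close>. A weak inequality is thus improved to a quantitative one.\<close>

lemma reflection_gap:
  assumes lam: "lam > 0" and good: "\<And>t x. 0 \<le> t \<Longrightarrow> t \<le> lam \<Longrightarrow> x \<in> K \<Longrightarrow> w t x \<le> w (2 * lam - t) x"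
    and \<eta>: "\<And>x. x \<in> K \<Longrightarrow> \<eta> \<le> w (2 * lam) x"
    and t: "0 \<le> t" "t \<le> lam" "x \<in> K"
  shows "\<eta> * sinh (c * (lam - t)) / sinh (c * lam) \<le> w (2 * lam - t) x - w t x"
proof (rule ccontr)
  assume neg: "\<not> ?thesis"
  define A where "A = \<eta> / sinh (c * lam)"
  define \<phi> where "\<phi> = (\<lambda>t. A * sinh (c * (lam - t)))"
  have "sinh (c * lam) \<noteq> 0" using assms c by simp
  then have \<phi>0: "\<phi> 0 = \<eta>"
    unfolding \<phi>_def A_def by simp
  obtain t0 x0 where t0: "0 \<le> t0" "t0 \<le> lam" "x0 \<in> K"
    and inf: "\<And>t x. 0 \<le> t \<Longrightarrow> t \<le> lam \<Longrightarrow> x \<in> K \<Longrightarrow>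
      w (2 * lam - t0) x0 - w t0 x0 - \<phi> t0 \<le> w (2 * lam - t) x - w t x - \<phi> t"
  proof (rule attains_inf[of 0 lam "\<lambda>t x. w (2 * lam - t) x - w t x - \<phi> t"])
    show "continuous_on ({0..lam} \<times> K) (\<lambda>z. w (2 * lam - fst z) (snd z) - w (fst z) (snd z) - \<phi> (fst z))"
      unfolding \<phi>_def using assms by (intro continuous_intros cont_w) auto
  qed (use assms in auto)
  have n0: "w (2 * lam - t0) x0 - w t0 x0 < \<phi> t0"
    using inf[OF t] neg by (auto simp: \<phi>_def A_def)
  have "t0 \<noteq> 0" "t0 \<noteq> lam" using n0 zero[OF t0(3)] \<eta>[OF t0(3)] \<phi>0 by (auto simp: \<phi>_def)
  then have t0': "0 < t0" "t0 < lam" using t0 by auto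
  have "0 \<le> c\<^sup>2 * (w (-1 * t0 + 2 * lam) x0 - 1 * w t0 x0)
    - (exp (\<alpha> * (-1 * t0 + 2 * lam)) * w (-1 * t0 + 2 * lam) x0 powr p - 1 * (exp (\<alpha> * t0) * w t0 x0 powr p))
    - 0 * w t0 x0 - 2 * 0 * w1 t0 x0 - (c * c * \<phi> t0)"
  proof (rule touch[OF t0(3) t0', where g = "\<lambda>_. 1" and ?g1.0 = "\<lambda>_. 0"
      and \<phi> = "\<phi>" and ?\<phi>1.0 = "\<lambda>t. - (A * c * cosh (c * (lam - t)))"])
    show "(\<phi> has_real_derivative - (A * c * cosh (c * (lam - t)))) (at t)" for t
      unfolding \<phi>_def by (auto intro!: derivative_eq_intros)
    show "((\<lambda>t. - (A * c * cosh (c * (lam - t)))) has_real_derivative c * c * \<phi> t0) (at t0)"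
      unfolding \<phi>_def by (auto intro!: derivative_eq_intros)
    fix t x assume "0 < t" "t < lam" "x \<in> K"
    then show "w (-1 * t0 + 2 * lam) x0 - 1 * w t0 x0 - \<phi> t0 \<le> w (-1 * t + 2 * lam) x - 1 * w t x - \<phi> t"
      using inf[of t x] by simp
  qed auto
  moreover have "exp (\<alpha> * t0) * w t0 x0 powr p
      \<le> exp (\<alpha> * (-1 * t0 + 2 * lam)) * w (-1 * t0 + 2 * lam) x0 powr p"
    using good[OF t0] w_nonneg[OF t0(1,3)] \<alpha> t0 p
    by (intro mult_mono powr_mono2) (auto intro!: mult_left_mono)
  ultimately have "0 \<le> c * c * (w (2 * lam - t0) x0 - w t0 x0 - \<phi> t0)"
    by (simp add: algebra_simps power2_eq_square)
  moreover have "c * c * (w (2 * lam - t0) x0 - w t0 x0 - \<phi> t0) < 0"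
    using n0 c by (intro mult_pos_neg) auto
  ultimately show False by simp
qed

text \<open>The maximum principle in narrow domains, which spares the Hopf lemma at the moving plane.\<close>

lemma narrow_strip:
  assumes p1: "p \<ge> 1" and \<beta>: "\<beta> > 0" "p * exp (2 * \<alpha> * L) * M powr (p - 1) \<le> \<beta>\<^sup>2"
    and M: "\<And>t x. 0 \<le> t \<Longrightarrow> t \<le> 2 * L \<Longrightarrow> x \<in> K \<Longrightarrow> w t x \<le> M"
    and a: "0 \<le> a" "a < lam" "lam \<le> L" "\<beta> * (lam - a) < pi / 2"
    and bd: "\<And>x. x \<in> K \<Longrightarrow> w a x \<le> w (2 * lam - a) x"
    and t: "a \<le> t" "t \<le> lam" "x \<in> K"
  shows "w t x \<le> w (2 * lam - t) x"
proof (rule ccontr)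
  assume neg: "\<not> ?thesis"
  \<comment> \<open>A piece of a cosine arch, positive on the closed strip since
    \<open>\<beta> * (lam - a) < pi / 2\<close>; the quotient by it may therefore be
    minimised.\<close>
  define \<psi> where "\<psi> = (\<lambda>t. cos (\<beta> * (t - a)))"
  have \<psi>: "\<psi> t > 0" if "a \<le> t" "t \<le> lam" for t
  proof -
    have "\<beta> * (t - a) \<le> \<beta> * (lam - a)" using that \<beta> by auto
    then have "\<beta> * (t - a) < pi / 2" using a(4) by linarith
    moreover have "- (pi / 2) < \<beta> * (t - a)"
      using that \<beta> order.strict_trans2[of "- (pi / 2)" 0 "\<beta> * (t - a)"] by simp
    ultimately show ?thesis unfolding \<psi>_def by (intro cos_gt_zero_pi)
  qed
  obtain t0 x0 where t0: "a \<le> t0" "t0 \<le> lam" "x0 \<in> K"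
    and inf: "\<And>t x. a \<le> t \<Longrightarrow> t \<le> lam \<Longrightarrow> x \<in> K \<Longrightarrow>
      (w (2 * lam - t0) x0 - w t0 x0) / \<psi> t0 \<le> (w (2 * lam - t) x - w t x) / \<psi> t"
  proof (rule attains_inf[of a lam "\<lambda>t x. (w (2 * lam - t) x - w t x) / \<psi> t"])
    have "continuous_on UNIV \<psi>" unfolding \<psi>_def by (intro continuous_intros)
    then have "continuous_on ({a..lam} \<times> K) (\<lambda>z. \<psi> (fst z))"
      by (rule continuous_on_compose2) (auto intro!: continuous_intros)
    then show "continuous_on ({a..lam} \<times> K) (\<lambda>z. (w (2 * lam - fst z) (snd z) - w (fst z) (snd z)) / \<psi> (fst z))"
      using assms by (intro continuous_intros cont_w ballI less_imp_neq[symmetric] \<psi>) auto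
  qed (use assms in auto)
  define k where "k = (w (2 * lam - t0) x0 - w t0 x0) / \<psi> t0"
  have "k \<le> (w (2 * lam - t) x - w t x) / \<psi> t" unfolding k_def by (rule inf[OF t])
  also have "\<dots> < 0" using neg \<psi>[OF t(1,2)] by (intro divide_neg_pos) auto
  finally have k: "k < 0" .
  have le: "k * \<psi> t \<le> w (2 * lam - t) x - w t x" if "a \<le> t" "t \<le> lam" "x \<in> K" for t x
    using inf[OF that] \<psi>[OF that(1,2)] by (simp add: k_def[symmetric] pos_le_divide_eq)
  have e0: "w (2 * lam - t0) x0 - w t0 x0 = k * \<psi> t0" using \<psi>[OF t0(1,2)] by (simp add: k_def)
  have neg0: "k * \<psi> t0 < 0" using k \<psi>[OF t0(1,2)] by (intro mult_neg_pos) auto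
  have "t0 \<noteq> a" "t0 \<noteq> lam" using neg0 e0 bd[OF t0(3)] by auto
  then have t0': "a < t0" "t0 < lam" using t0 by auto
  have "0 \<le> c\<^sup>2 * (w (-1 * t0 + 2 * lam) x0 - 1 * w t0 x0)
    - (exp (\<alpha> * (-1 * t0 + 2 * lam)) * w (-1 * t0 + 2 * lam) x0 powr p - 1 * (exp (\<alpha> * t0) * w t0 x0 powr p))
    - 0 * w t0 x0 - 2 * 0 * w1 t0 x0 - (- (k * \<beta> * \<beta> * \<psi> t0))"
  proof (rule touch[OF t0(3) t0', where g = "\<lambda>_. 1" and ?g1.0 = "\<lambda>_. 0"
      and \<phi> = "\<lambda>t. k * \<psi> t" and ?\<phi>1.0 = "\<lambda>t. - (k * \<beta> * sin (\<beta> * (t - a)))"])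
    show "((\<lambda>t. k * \<psi> t) has_real_derivative - (k * \<beta> * sin (\<beta> * (t - a)))) (at t)" for t
      unfolding \<psi>_def by (auto intro!: derivative_eq_intros)
    show "((\<lambda>t. - (k * \<beta> * sin (\<beta> * (t - a)))) has_real_derivative - (k * \<beta> * \<beta> * \<psi> t0)) (at t0)"
      unfolding \<psi>_def by (auto intro!: derivative_eq_intros)
    fix t x assume "a < t" "t < lam" "x \<in> K"
    then show "w (-1 * t0 + 2 * lam) x0 - 1 * w t0 x0 - k * \<psi> t0 \<le> w (-1 * t + 2 * lam) x - 1 * w t x - k * \<psi> t"
      using le[of t x] e0 by simp
  qed (use a in auto)
  \<comment> \<open>The weight is smaller at \<open>t0\<close> than at its reflection, and the
    Lipschitz constant is at most \<open>\<beta>\<^sup>2\<close>. The second derivative of the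
    barrier absorbs exactly this much, which leaves only the negative term
    \<open>c\<^sup>2 * (k * \<psi> t0)\<close>.\<close>
  moreover have "exp (\<alpha> * t0) * w t0 x0 powr p
      - exp (\<alpha> * (-1 * t0 + 2 * lam)) * w (-1 * t0 + 2 * lam) x0 powr p \<le> \<beta>\<^sup>2 * - (k * \<psi> t0)"
  proof -
    have q: "0 < w (2 * lam - t0) x0" "w (2 * lam - t0) x0 \<le> w t0 x0" "w t0 x0 \<le> M" "w t0 x0 > 0"
      using t0' a e0 neg0 M[of t0 x0] t0 pos by auto
    have "exp (\<alpha> * t0) * w (2 * lam - t0) x0 powr p \<le> exp (\<alpha> * (-1 * t0 + 2 * lam)) * w (-1 * t0 + 2 * lam) x0 powr p"
      using \<alpha> t0 a by (intro mult_mono) (auto intro!: mult_left_mono)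
    then have "exp (\<alpha> * t0) * w t0 x0 powr p
      - exp (\<alpha> * (-1 * t0 + 2 * lam)) * w (-1 * t0 + 2 * lam) x0 powr p
       \<le> exp (\<alpha> * t0) * (w t0 x0 powr p - w (2 * lam - t0) x0 powr p)"
      by (simp add: algebra_simps)
    also have "\<dots> \<le> exp (2 * \<alpha> * L) * (p * M powr (p - 1) * (w t0 x0 - w (2 * lam - t0) x0))"
    proof (intro mult_mono powr_diff_le q p1)
      show "exp (\<alpha> * t0) \<le> exp (2 * \<alpha> * L)" using \<alpha> t0 a
        by (simp add: mult.commute[of _ \<alpha>] mult.assoc mult_left_mono)
    qed (use q p in \<open>auto intro!: powr_mono2\<close>)
    also have "\<dots> = (p * exp (2 * \<alpha> * L) * M powr (p - 1)) * - (k * \<psi> t0)"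
      using e0 by (simp add: algebra_simps flip: e0)
    also have "\<dots> \<le> \<beta>\<^sup>2 * - (k * \<psi> t0)"
      using \<beta> neg0 by (intro mult_right_mono) auto
    finally show ?thesis .
  qed
  moreover have "c\<^sup>2 * (w (-1 * t0 + 2 * lam) x0 - 1 * w t0 x0) = c\<^sup>2 * (k * \<psi> t0)"
    using e0 by simp
  ultimately have "0 \<le> c\<^sup>2 * (k * \<psi> t0)"
    unfolding power2_eq_square by (simp only: mult_ac)
  moreover have "c\<^sup>2 * (k * \<psi> t0) < 0"
    using neg0 c mult_pos_neg[of "c\<^sup>2" "k * \<psi> t0"] by simp
  ultimately show False by simp
qed

text \<open>The width \<open>d\<close> depends only on \<open>L\<close>, not on the position \<open>lam\<close> of the plane.\<close>

lemma obtain_strip_width: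
  assumes p1: "p \<ge> 1" and L: "L > 0"
  obtains d where "d > 0" "\<And>a lam t x. 0 \<le> a \<Longrightarrow> a < lam \<Longrightarrow> lam \<le> L \<Longrightarrow> lam - a < d \<Longrightarrow>
      (\<And>x. x \<in> K \<Longrightarrow> w a x \<le> w (2 * lam - a) x) \<Longrightarrow> a \<le> t \<Longrightarrow> t \<le> lam \<Longrightarrow> x \<in> K \<Longrightarrow> w t x \<le> w (2 * lam - t) x"
proof -
  obtain t1 x1 where t1: "0 \<le> t1" "t1 \<le> 2 * L" "x1 \<in> K" and
    M: "\<And>t x. 0 \<le> t \<Longrightarrow> t \<le> 2 * L \<Longrightarrow> x \<in> K \<Longrightarrow> - w t1 x1 \<le> - w t x"
  proof (rule attains_inf[of 0 "2 * L" "\<lambda>t x. - w t x"])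
    show "continuous_on ({0..2 * L} \<times> K) (\<lambda>z. - w (fst z) (snd z))"
      by (intro continuous_intros cont_w) auto
  qed (use L in auto)
  define C where "C = p * exp (2 * \<alpha> * L) * w t1 x1 powr (p - 1)"
  \<comment> \<open>Positive even for \<open>C = 0\<close>, and its square is at least
    \<open>C\<close> whatever the size of \<open>C\<close>.\<close>
  define \<beta> where "\<beta> = 1 + C"
  have C: "C \<ge> 0" using p by (auto simp: C_def)
  have \<beta>: "\<beta> > 0" "C \<le> \<beta>\<^sup>2" using C by (auto simp: \<beta>_def power2_eq_square algebra_simps)
  show ?thesis
  proof (rule that)
    show "pi / (2 * \<beta>) > 0" using \<beta> by simp
    fix a lam t x assume h: "0 \<le> a" "a < lam" "lam \<le> L" "lam - a < pi / (2 * \<beta>)"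
      "\<And>x. x \<in> K \<Longrightarrow> w a x \<le> w (2 * lam - a) x" "a \<le> t" "t \<le> lam" "x \<in> K"
    have "\<beta> * (lam - a) < pi / 2" using h(4) \<beta> by (simp add: field_simps)
    then show "w t x \<le> w (2 * lam - t) x"
      using h \<beta> M by (intro narrow_strip[OF p1 \<beta>(1), of L "w t1 x1" a lam t x]) (auto simp: C_def)
  qed
qed

text \<open>The positions \<open>lam\<close> for which the reflection dominates form a nonempty set
  that is open and closed in the connected half-line.\<close>

lemma reflection_nonneg:
  assumes p1: "p \<ge> 1" and "lam > 0" "0 \<le> t" "t \<le> lam" "x \<in> K"
  shows "w t x \<le> w (2 * lam - t) x"
proof -
  define good where "good lam \<longleftrightarrow> (\<forall>t x. 0 \<le> t \<longrightarrow> t \<le> lam \<longrightarrow> x \<in> K \<longrightarrow> w t x \<le> w (2 * lam - t) x)" for lam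
  define G where "G = {lam. 0 < lam \<and> good lam}"
  have closed: "closedin (top_of_set {0<..}) G"
  proof -
    \<comment> \<open>Writing \<open>t = r * lam\<close> makes the index set independent of
      \<open>lam\<close>, so that \<open>G\<close> is an intersection of closed conditions on
      \<open>lam\<close>.\<close>
    define B where "B = (\<lambda>(r::real, x). {0<..} \<inter> (\<lambda>lam. w ((2 - r) * lam) x - w (r * lam) x) -` {0..})"
    have "G = (\<Inter>i\<in>{0..1} \<times> K. B i)"
    proof (intro equalityI subsetI)
      fix lam assume "lam \<in> G"
      then have l: "0 < lam" "\<And>t x. 0 \<le> t \<Longrightarrow> t \<le> lam \<Longrightarrow> x \<in> K \<Longrightarrow> w t x \<le> w (2 * lam - t) x"
        by (auto simp: G_def good_def)
      have "w (r * lam) x \<le> w ((2 - r) * lam) x" if "0 \<le> r" "r \<le> 1" "x \<in> K" for r x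
        using l(2)[of "r * lam" x] that l(1) by (simp add: algebra_simps)
      then show "lam \<in> (\<Inter>i\<in>{0..1} \<times> K. B i)" using l(1) by (auto simp: B_def)
    next
      fix lam assume "lam \<in> (\<Inter>i\<in>{0..1} \<times> K. B i)"
      then have l: "\<And>r x. 0 \<le> r \<Longrightarrow> r \<le> 1 \<Longrightarrow> x \<in> K \<Longrightarrow> 0 < lam \<and> w (r * lam) x \<le> w ((2 - r) * lam) x"
        by (force simp: B_def)
      obtain x1 where "x1 \<in> K" using K by auto
      then have l0: "0 < lam" using l[of 0 x1] by simp
      have "w t x \<le> w (2 * lam - t) x" if "0 \<le> t" "t \<le> lam" "x \<in> K" for t x
        using l[of "t / lam" x] that l0 by (simp add: algebra_simps)
      then show "lam \<in> G" using l0 by (auto simp: G_def good_def)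
    qed
    moreover have "closedin (top_of_set {0<..}) (B i)" if "i \<in> {0..1} \<times> K" for i
      using that unfolding B_def case_prod_unfold
      by (intro continuous_closedin_preimage continuous_intros cont_w) auto
    ultimately show ?thesis using K by (auto intro!: closedin_INT)
  qed
  have "openin (top_of_set {0<..}) G"
    unfolding openin_euclidean_subtopology_iff
  proof (intro conjI ballI)
    show "G \<subseteq> {0<..}" by (auto simp: G_def)
    fix lam assume "lam \<in> G"
    then have l: "0 < lam" "\<And>t x. 0 \<le> t \<Longrightarrow> t \<le> lam \<Longrightarrow> x \<in> K \<Longrightarrow> w t x \<le> w (2 * lam - t) x"
      by (auto simp: G_def good_def)
    obtain d where d: "d > 0" and narrow: "\<And>a lam' t x. 0 \<le> a \<Longrightarrow> a < lam' \<Longrightarrow> lam' \<le> lam + 1 \<Longrightarrow> lam' - a < d \<Longrightarrow>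
      (\<And>x. x \<in> K \<Longrightarrow> w a x \<le> w (2 * lam' - a) x) \<Longrightarrow> a \<le> t \<Longrightarrow> t \<le> lam' \<Longrightarrow> x \<in> K \<Longrightarrow> w t x \<le> w (2 * lam' - t) x"
      using obtain_strip_width[OF p1, of "lam + 1"] l(1) by (metis add_pos_pos zero_less_one)
    \<comment> \<open>The region up to the plane is split at \<open>a\<close>: on
      \<open>[0, a]\<close> a positive gap \<open>m\<close> survives small moves of the plane, and
      the remainder is a strip narrower than \<open>d\<close>.\<close>
    define a where "a = max 0 (lam - d / 2)"
    have a: "0 \<le> a" "a < lam" "lam - d / 2 \<le> a" using d l(1) by (auto simp: a_def)
    obtain y where y: "y \<in> K" "\<And>x. x \<in> K \<Longrightarrow> w (2 * lam) y \<le> w (2 * lam) x"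
      using slice_attains_inf[of "2 * lam"] l(1) by auto
    define m where "m = w (2 * lam) y * sinh (c * (lam - a)) / sinh (c * lam)"
    have m: "m > 0" using c a l(1) pos[OF _ y(1)] by (simp add: m_def)
    have gap: "m \<le> w (2 * lam - t) x - w t x" if "0 \<le> t" "t \<le> a" "x \<in> K" for t x
    proof -
      have "m \<le> w (2 * lam) y * sinh (c * (lam - t)) / sinh (c * lam)"
        unfolding m_def using that c l(1) pos[OF _ y(1), of "2 * lam"]
        by (intro divide_right_mono mult_left_mono) auto
      also have "\<dots> \<le> w (2 * lam - t) x - w t x"
        using reflection_gap[OF l(1,2), of "w (2 * lam) y" t x] y that a by auto
      finally show ?thesis .
    qed
    have "uniformly_continuous_on ({0..2 * lam + 2} \<times> K) (\<lambda>z. w (fst z) (snd z))"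
      using K by (intro compact_uniformly_continuous compact_Times cont_w continuous_intros) auto
    then obtain e where e: "e > 0" "\<And>z z'. z \<in> {0..2 * lam + 2} \<times> K \<Longrightarrow> z' \<in> {0..2 * lam + 2} \<times> K \<Longrightarrow>
      dist z' z < e \<Longrightarrow> dist (w (fst z') (snd z')) (w (fst z) (snd z)) < m"
      unfolding uniformly_continuous_on_def using m by meson
    \<comment> \<open>The reflected point moves twice as far as the plane, hence
      \<open>e / 2\<close>; \<open>d / 2\<close> keeps the strip narrower than \<open>d\<close>;
      \<open>1\<close> keeps the plane in the range of \<open>narrow\<close> and of the uniform
      continuity; \<open>lam - a\<close> keeps it beyond \<open>a\<close>.\<close>
    define r where "r = min (min (e / 2) (d / 2)) (min 1 (lam - a))"
    have r: "r > 0" "r \<le> e / 2" "r \<le> d / 2" "r \<le> 1" "r \<le> lam - a"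
      using e(1) d a unfolding r_def by linarith+
    show "\<exists>e>0. \<forall>x'\<in>{0<..}. dist x' lam < e \<longrightarrow> x' \<in> G"
    proof (intro exI[of _ r] conjI ballI impI r(1))
      fix lam' :: real assume lam': "lam' \<in> {0<..}" "dist lam' lam < r"
      then have b: "lam' > lam - r" "lam' < lam + r" by (auto simp: dist_real_def)
      have near: "w t x \<le> w (2 * lam' - t) x" if "0 \<le> t" "t \<le> a" "x \<in> K" for t x
      proof -
        have "dist (w (2 * lam' - t) x) (w (2 * lam - t) x) < m"
          using e(2)[of "(2 * lam - t, x)" "(2 * lam' - t, x)"] that b r a
          by (auto simp: dist_Pair_Pair dist_real_def)
        then show ?thesis using gap[OF that] by (auto simp: dist_real_def)
      qed
      have "w t x \<le> w (2 * lam' - t) x" if "0 \<le> t" "t \<le> lam'" "x \<in> K" for t x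
      proof (cases "t \<le> a")
        case False
        then show ?thesis using that b r a near
          by (intro narrow[of a lam' t x]) auto
      qed (use near that in auto)
      then show "lam' \<in> G" using lam' by (auto simp: G_def good_def)
    qed
  qed
  moreover have "G \<noteq> {}"
  proof -
    obtain d where d: "d > 0" and narrow: "\<And>a lam' t x. 0 \<le> a \<Longrightarrow> a < lam' \<Longrightarrow> lam' \<le> 1 \<Longrightarrow> lam' - a < d \<Longrightarrow>
      (\<And>x. x \<in> K \<Longrightarrow> w a x \<le> w (2 * lam' - a) x) \<Longrightarrow> a \<le> t \<Longrightarrow> t \<le> lam' \<Longrightarrow> x \<in> K \<Longrightarrow> w t x \<le> w (2 * lam' - t) x"
      using obtain_strip_width[OF p1, of 1] by (metis zero_less_one)
    \<comment> \<open>For a plane this close to \<open>0\<close> the whole interval up to it is a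
      narrow strip, and \<open>w\<close> vanishes at the left end.\<close>
    have "w t x \<le> w (2 * min 1 (d / 2) - t) x" if "0 \<le> t" "t \<le> min 1 (d / 2)" "x \<in> K" for t x
      by (rule narrow[of 0 "min 1 (d / 2)" t x]) (use d that zero w_nonneg in auto)
    then have "min 1 (d / 2) \<in> G" using d by (auto simp: G_def good_def)
    then show ?thesis by auto
  qed
  moreover have "connected {0::real<..}" by simp
  ultimately have "G = {0<..}" using closed unfolding connected_clopen by blast
  then show ?thesis using assms by (auto simp: G_def good_def)
qed

text \<open>By \<open>reflection_gap\<close>, \<open>F\<close> is nonnegative before
  \<open>lam\<close> and vanishes there, so its derivative \<open>\<eta> * c - 2 * w1 lam x\<close>
  at \<open>lam\<close> is at most 0. The slope of the \<open>sinh\<close> at the plane makes the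
  conclusion strict.\<close>

lemma w1_pos:
  assumes p1: "p \<ge> 1" and lam: "lam > 0" and x: "x \<in> K"
  shows "w1 lam x > 0"
proof -
  obtain y where y: "y \<in> K" "\<And>x. x \<in> K \<Longrightarrow> w (2 * lam) y \<le> w (2 * lam) x"
    using slice_attains_inf[of "2 * lam"] lam by auto
  define \<eta> where "\<eta> = w (2 * lam) y / sinh (c * lam)"
  have \<eta>: "\<eta> > 0" using c lam pos[OF _ y(1)] by (simp add: \<eta>_def)
  define F where "F t = w (2 * lam - t) x - w t x - \<eta> * sinh (c * (lam - t))" for t
  have F: "F t \<ge> 0" if "0 \<le> t" "t \<le> lam" for t
    using reflection_gap[OF lam reflection_nonneg[OF p1 lam] y(2) that x] by (simp add: F_def \<eta>_def)
  have "((\<lambda>t. w (2 * lam - t) x) has_real_derivative w1 (2 * lam - lam) x * - 1) (at lam)"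
    using lam by (intro DERIV_chain2[OF w1[OF _ x]]) (auto intro!: derivative_eq_intros)
  then have F': "(F has_real_derivative - (2 * w1 lam x) + \<eta> * c) (at lam)"
    unfolding F_def using lam by (auto intro!: derivative_eq_intros w1 x)
  have "- (2 * w1 lam x) + \<eta> * c \<le> 0"
  proof (rule ccontr)
    assume "\<not> ?thesis"
    then obtain d where d: "d > 0" "\<And>h. h > 0 \<Longrightarrow> h < d \<Longrightarrow> F (lam - h) < F lam"
      using DERIV_pos_inc_left[OF F'] by auto
    have "F (lam - min d lam / 2) < F lam" using d(1) lam by (intro d(2)) auto
    moreover have "F lam = 0" by (simp add: F_def)
    moreover have "F (lam - min d lam / 2) \<ge> 0" using d(1) lam by (intro F) auto
    ultimately show False by simp
  qed
  moreover have "\<eta> * c > 0" using \<eta> c by simp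
  ultimately show ?thesis by linarith
qed

lemma w_strict_mono:
  assumes "p \<ge> 1" "0 < s" "s < t" "x \<in> K"
  shows "w s x < w t x"
proof (rule DERIV_pos_imp_increasing[OF assms(3)])
  fix r assume "s \<le> r"
  then have "r > 0" using assms(2) by simp
  then show "\<exists>y. ((\<lambda>t. w t x) has_real_derivative y) (at r) \<and> 0 < y"
    using w1[of r x] w1_pos[OF assms(1), of r x] assms(4) by blast
qed

section \<open>Contradictions in the three ranges of exponents\<close>

text \<open>By \<open>sine_barrier\<close>, the right-hand side of \<open>grow\<close> is at most
  \<open>c\<^sup>2 + pi\<^sup>2\<close> somewhere in every interval of length 1.\<close>

lemma not_exponential_growth:
  assumes B: "B > 0" "r > 0" and A: "A > 0"
    and grow: "\<And>t x. t \<ge> A \<Longrightarrow> x \<in> K \<Longrightarrow> B * exp (r * t) \<le> exp (\<alpha> * t) * w t x powr (p - 1)"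
  shows False
proof -
  obtain a where a: "a \<ge> A" "c\<^sup>2 + pi\<^sup>2 < B * exp (r * a)"
    by (rule exp_unbounded[OF B])
  have "0 < a" "a < a + 1" using a A by auto
  then obtain s t0 x0 where t0: "a < t0" "x0 \<in> K"
    "exp (\<alpha> * t0) * w t0 x0 powr (p - 1) \<le> c\<^sup>2 + (pi / (a + 1 - a))\<^sup>2"
    by (rule sine_barrier) (rule that, assumption+)
  have "B * exp (r * a) \<le> B * exp (r * t0)" using B t0 by simp
  then show False using grow[of t0 x0] t0 a by simp
qed

text \<open>For \<open>p \<le> 1\<close> an upper bound on \<open>w\<close> is a lower bound on
  \<open>w powr (p - 1)\<close>. At the touching point \<open>w \<le> s\<close>, and
  \<open>sinh_comparison\<close> gives \<open>s = O(exp (c * a))\<close>; hence the quantity in the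
  barrier estimate is at least a constant times \<open>exp (r * a)\<close> with
  \<open>r > 0\<close>.\<close>

lemma contradiction_sublinear:
  assumes p1: "p \<le> 1"
  shows False
proof -
  obtain x1 where x1: "x1 \<in> K" using K by auto
  \<comment> \<open>Chosen so that comparison at \<open>t = 1\<close> yields
    \<open>s \<le> B * exp (c * a)\<close>; the factor \<open>exp (c / 2)\<close> comes from the
    midpoint \<open>a + 1 / 2\<close> of the interval.\<close>
  define B where "B = w 1 x1 * exp (c / 2) / sinh c"
  define r where "r = \<alpha> + c * (p - 1)"
  have B: "B > 0" using c pos x1 by (simp add: B_def)
  obtain a where a: "a \<ge> 1" "c\<^sup>2 + pi\<^sup>2 < B powr (p - 1) * exp (r * a)"
    using exp_unbounded[of "B powr (p - 1)" r 1] B subcritical by (auto simp: r_def)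
  have "0 < a" "a < a + 1" using a(1) by auto
  then obtain s t0 x0 where t0: "a < t0" "t0 < a + 1" "x0 \<in> K" "s > 0"
    and mid: "\<And>x. x \<in> K \<Longrightarrow> s \<le> w ((a + (a + 1)) / 2) x" and ws: "w t0 x0 \<le> s"
    and q: "exp (\<alpha> * t0) * w t0 x0 powr (p - 1) \<le> c\<^sup>2 + (pi / (a + 1 - a))\<^sup>2"
    by (rule sine_barrier) (rule that, assumption+)
  have "s * sinh (c * 1) / sinh (c * (a + 1 / 2)) \<le> w 1 x1"
    using mid a(1) t0(4) x1 by (intro sinh_comparison) (auto simp: add_divide_distrib)
  then have "s * sinh c \<le> w 1 x1 * sinh (c * (a + 1 / 2))"
    using a c by (simp add: pos_divide_le_eq)
  also have "\<dots> \<le> w 1 x1 * exp (c * (a + 1 / 2))"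
    using pos[OF _ x1, of 1] by (intro mult_left_mono) (auto simp: sinh_def field_simps)
  also have "\<dots> = B * exp (c * a) * sinh c"
    using c by (simp add: B_def exp_add[symmetric] algebra_simps)
  finally have s: "s \<le> B * exp (c * a)" using c by simp
  have "B powr (p - 1) * exp (r * a) = exp (\<alpha> * a) * (B * exp (c * a)) powr (p - 1)"
    using B by (simp add: r_def powr_mult exp_powr_real algebra_simps flip: exp_add)
  also have "\<dots> \<le> exp (\<alpha> * t0) * w t0 x0 powr (p - 1)"
  proof (intro mult_mono powr_mono2')
    show "w t0 x0 \<le> B * exp (c * a)" using ws s by simp
  qed (use p1 \<alpha> t0 a pos in \<open>auto intro!: mult_left_mono\<close>)
  finally show False using q a by simp
qed

lemma contradiction_superlinear_subcritical:
  assumes p1: "p > 1" and \<alpha>0: "\<alpha> > 0"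
  shows False
proof -
  obtain y where y: "y \<in> K" "\<And>x. x \<in> K \<Longrightarrow> w 1 y \<le> w 1 x"
    using slice_attains_inf[of 1] by auto
  show False
  proof (rule not_exponential_growth[of "w 1 y powr (p - 1)" \<alpha> 1])
    fix t :: real and x assume t: "1 \<le> t" "x \<in> K"
    then have "w 1 y \<le> w t x"
      using y(2)[of x] w_strict_mono[of 1 t x] p1 by (cases "t = 1") auto
    then have "w 1 y powr (p - 1) \<le> w t x powr (p - 1)"
      using p1 w_nonneg[of 1 y] y by (intro powr_mono2) auto
    then show "w 1 y powr (p - 1) * exp (\<alpha> * t) \<le> exp (\<alpha> * t) * w t x powr (p - 1)" by simp
  qed (use \<alpha>0 pos[of 1 y] y in auto)
qed

lemma contradiction_critical:
  assumes p1: "p > 1" and \<alpha>0: "\<alpha> = 0"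
  shows False
proof -
  obtain y where y: "y \<in> K" "\<And>x. x \<in> K \<Longrightarrow> w 1 y \<le> w 1 x"
    using slice_attains_inf[of 1] by auto
  define \<delta> where "\<delta> = w 1 y"
  have \<delta>: "\<delta> > 0" using pos y by (simp add: \<delta>_def)
  have w\<delta>: "\<delta> \<le> w t x" if "t \<ge> 1" "x \<in> K" for t x
    using y(2)[of x] w_strict_mono[of 1 t x] p1 that by (cases "t = 1") (auto simp: \<delta>_def)
  \<comment> \<open>\<open>\<kappa> = q\<^sup>2\<close>; the constants make \<open>\<nu>\<^sup>2 + 2 \<nu> (4 s1) = \<kappa> / 2 < \<kappa>\<close>.\<close>
  define q where "q = sqrt ((p - 1) * \<delta> powr (p - 1))"
  have q: "q > 0" "q\<^sup>2 = (p - 1) * \<delta> powr (p - 1)" using p1 \<delta> by (auto simp: q_def)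
  define \<nu> where "\<nu> = q / 2"
  define s1 where "s1 = q / 16"
  define h where "h = pi / \<nu> / 2"
  have \<nu>: "\<nu> > 0" "s1 > 0" "h > 0" "\<nu> * h = pi / 2" using q by (auto simp: \<nu>_def s1_def h_def)
  \<comment> \<open>If \<open>w1 \<ge> s1 * w\<close> held for all \<open>t \<ge> 1 + h\<close>,
    then \<open>w\<close> would grow exponentially. The offset \<open>h\<close> leaves room for the
    interval \<open>[t1 - h, t1 + h]\<close> within \<open>t \<ge> 1\<close>.\<close>
  obtain t1 x1 where t1: "t1 \<ge> 1 + h" "x1 \<in> K" "w1 t1 x1 < s1 * w t1 x1"
  proof (rule ccontr)
    assume n: "\<not> thesis"
    note I = that
    have g: "s1 * w t x \<le> w1 t x" if "t \<ge> 1 + h" "x \<in> K" for t x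
      using I[OF that] n by linarith
    define B where "B = \<delta> * exp (- s1 * (1 + h))"
    have grow: "B * exp (s1 * t) \<le> w t x" if "t \<ge> 1 + h" "x \<in> K" for t x
    proof -
      have "w (1 + h) x * exp (- s1 * (1 + h)) \<le> w t x * exp (- s1 * t)"
      proof (rule DERIV_nonneg_imp_nondecreasing[OF that(1)])
        fix t assume t: "1 + h \<le> t"
        have "((\<lambda>t. w t x * exp (- s1 * t)) has_real_derivative (w1 t x - s1 * w t x) * exp (- s1 * t)) (at t)"
          using t \<nu> that by (auto intro!: derivative_eq_intros w1 simp: algebra_simps)
        moreover have "(w1 t x - s1 * w t x) * exp (- s1 * t) \<ge> 0"
          using g[OF t that(2)] by simp
        ultimately show "\<exists>y. ((\<lambda>t. w t x * exp (- s1 * t)) has_real_derivative y) (at t) \<and> 0 \<le> y"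
          by blast
      qed
      moreover have "B \<le> w (1 + h) x * exp (- s1 * (1 + h))"
        unfolding B_def using w\<delta> that \<nu> by (intro mult_right_mono) auto
      ultimately have "B \<le> w t x * exp (- s1 * t)" by linarith
      then show ?thesis by (simp add: exp_minus field_simps)
    qed
    show False
    proof (rule not_exponential_growth[of "B powr (p - 1)" "s1 * (p - 1)" "1 + h"])
      fix t x assume t: "1 + h \<le> t" "x \<in> K"
      have "B powr (p - 1) * exp (s1 * (p - 1) * t) = (B * exp (s1 * t)) powr (p - 1)"
        using \<delta> by (simp add: B_def powr_mult exp_powr_real algebra_simps)
      also have "\<dots> \<le> w t x powr (p - 1)"
        using grow[OF t] p1 \<delta> by (intro powr_mono2) (auto simp: B_def)
      finally show "B powr (p - 1) * exp (s1 * (p - 1) * t) \<le> exp (\<alpha> * t) * w t x powr (p - 1)"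
        using \<alpha>0 by simp
    qed (use \<delta> p1 \<nu> in \<open>auto simp: B_def\<close>)
  qed
  define a where "a = t1 - h"
  define b where "b = t1 + h"
  have ab: "1 \<le> a" "a < t1" "t1 < b" using t1 \<nu> by (auto simp: a_def b_def)
  obtain t2 x2 where t2: "a \<le> t2" "x2 \<in> K"
    and w1min: "\<And>t x. a \<le> t \<Longrightarrow> t \<le> b + 1 \<Longrightarrow> x \<in> K \<Longrightarrow> w1 t2 x2 \<le> w1 t x"
  proof (rule attains_inf[of a "b + 1" w1])
    show "continuous_on ({a..b + 1} \<times> K) (\<lambda>z. w1 (fst z) (snd z))"
      using ab by (intro cont_w1 continuous_intros) auto
  qed (use ab in auto)
  define m where "m = w1 t2 x2"
  have m: "m > 0" using w1_pos p1 t2 ab by (simp add: m_def)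
  have "uniformly_continuous_on ({a..b + 1} \<times> K) (\<lambda>z. w1 (fst z) (snd z))"
    using K ab by (intro compact_uniformly_continuous compact_Times cont_w1 continuous_intros) auto
  then obtain e where e: "e > 0" "\<And>z z'. z \<in> {a..b + 1} \<times> K \<Longrightarrow> z' \<in> {a..b + 1} \<times> K \<Longrightarrow>
      dist z' z < e \<Longrightarrow> dist (w1 (fst z') (snd z')) (w1 (fst z) (snd z)) < m / 2"
    unfolding uniformly_continuous_on_def using m by (meson half_gt_zero)
  \<comment> \<open>Over a step \<open>\<epsilon>\<close> the derivative varies by less than half of
    its minimum \<open>m\<close>, so increments of \<open>w\<close> agree with
    \<open>\<epsilon> * w1\<close> up to a factor 2 either way; \<open>1\<close> keeps the shifted
    points in \<open>[a, b + 1]\<close>.\<close>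
  define \<epsilon> where "\<epsilon> = min 1 (e / 2)"
  have \<epsilon>: "\<epsilon> > 0" "\<epsilon> \<le> 1" "\<epsilon> < e" using e(1) by (auto simp: \<epsilon>_def min_def)
  have diff: "\<epsilon> * w1 t x / 2 \<le> w (t + \<epsilon>) x - w t x" "w (t + \<epsilon>) x - w t x \<le> 2 * \<epsilon> * w1 t x"
    if "a \<le> t" "t \<le> b" "x \<in> K" for t x
  proof -
    have "\<exists>z>t. z < t + \<epsilon> \<and> w (t + \<epsilon>) x - w t x = (t + \<epsilon> - t) * w1 z x"
      using \<epsilon> ab that by (intro MVT2 w1) auto
    then obtain z where z: "t < z" "z < t + \<epsilon>" "w (t + \<epsilon>) x - w t x = \<epsilon> * w1 z x" by auto
    have "dist (w1 z x) (w1 t x) < m / 2"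
      using e(2)[of "(t, x)" "(z, x)"] z \<epsilon> that by (auto simp: dist_Pair_Pair dist_real_def)
    moreover have "m \<le> w1 t x" unfolding m_def using that by (intro w1min) auto
    ultimately have "w1 t x / 2 \<le> w1 z x" "w1 z x \<le> 2 * w1 t x" using m
      by (auto simp: dist_real_def abs_if split: if_splits)
    then have "\<epsilon> * (w1 t x / 2) \<le> \<epsilon> * w1 z x" "\<epsilon> * w1 z x \<le> \<epsilon> * (2 * w1 t x)"
      using \<epsilon> by (auto intro!: mult_left_mono)
    then show "\<epsilon> * w1 t x / 2 \<le> w (t + \<epsilon>) x - w t x" "w (t + \<epsilon>) x - w t x \<le> 2 * \<epsilon> * w1 t x"
      using z by auto
  qed
  define \<psi> where "\<psi> = (\<lambda>t. sin (\<nu> * (t - a)))"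
  have ang: "\<nu> * (t1 - a) = pi / 2" "\<nu> * (b - a) = pi"
    using \<nu>(4) by (simp_all add: a_def b_def algebra_simps)
  then have mid: "\<psi> t1 = 1" and ends: "\<psi> a = 0" "\<psi> b = 0"
    unfolding \<psi>_def ang by simp_all
  have wpos: "w t x > 0" if "a \<le> t" "x \<in> K" for t x using pos ab that by auto
  have incr: "w (t + \<epsilon>) x - w t x > 0" if "a \<le> t" "x \<in> K" for t x
    using w_strict_mono[of t "t + \<epsilon>" x] p1 that ab \<epsilon> by auto
  obtain t0 x0 where t0: "a \<le> t0" "t0 \<le> b" "x0 \<in> K"
    and inf: "\<And>t x. a \<le> t \<Longrightarrow> t \<le> b \<Longrightarrow> x \<in> K \<Longrightarrow>
      - (\<psi> t0 * w t0 x0) / (w (t0 + \<epsilon>) x0 - w t0 x0) \<le> - (\<psi> t * w t x) / (w (t + \<epsilon>) x - w t x)"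
  proof (rule attains_inf[of a b "\<lambda>t x. - (\<psi> t * w t x) / (w (t + \<epsilon>) x - w t x)"])
    have "continuous_on UNIV \<psi>" unfolding \<psi>_def by (intro continuous_intros)
    then have "continuous_on ({a..b} \<times> K) (\<lambda>z. \<psi> (fst z))"
      by (rule continuous_on_compose2) (auto intro!: continuous_intros)
    then show "continuous_on ({a..b} \<times> K) (\<lambda>z. - (\<psi> (fst z) * w (fst z) (snd z)) / (w (fst z + \<epsilon>) (snd z) - w (fst z) (snd z)))"
      using ab \<epsilon> by (intro continuous_intros cont_w ballI less_imp_neq[symmetric] incr) auto
  qed (use ab in auto)
  have "0 < w t1 x1 / (w (t1 + \<epsilon>) x1 - w t1 x1)"
    using incr wpos t1 ab by simp
  also have "\<dots> \<le> \<psi> t0 * w t0 x0 / (w (t0 + \<epsilon>) x0 - w t0 x0)"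
    using inf[of t1 x1] mid t1 ab by simp
  finally have "\<psi> t0 * w t0 x0 > 0" using incr[OF t0(1,3)] by (simp add: zero_less_divide_iff)
  then have \<psi>0: "\<psi> t0 > 0" using wpos[OF t0(1,3)] by (simp add: zero_less_mult_iff)
  then have t0': "a < t0" "t0 < b" using ends t0 by (auto simp: less_le)
  \<comment> \<open>The largest multiple of the sine arch that stays below the relative increment
    \<open>(w (t + \<epsilon>) x - w t x) / w t x\<close>.\<close>
  define s where "s = (w (t0 + \<epsilon>) x0 - w t0 x0) / (\<psi> t0 * w t0 x0)"
  have s: "s > 0" using \<psi>0 wpos[OF t0(1,3)] incr[OF t0(1,3)] by (simp add: s_def)
  have le: "s * \<psi> t * w t x \<le> w (t + \<epsilon>) x - w t x" if "a \<le> t" "t \<le> b" "x \<in> K" for t x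
  proof -
    have "\<psi> t * w t x / (w (t + \<epsilon>) x - w t x) \<le> 1 / s"
      using inf[OF that] by (simp add: s_def)
    then have "\<psi> t * w t x \<le> 1 / s * (w (t + \<epsilon>) x - w t x)"
      using incr[OF that(1,3)] by (simp only: pos_divide_le_eq)
    then have "s * (\<psi> t * w t x) \<le> s * (1 / s * (w (t + \<epsilon>) x - w t x))"
      using s by (intro mult_left_mono) auto
    then show ?thesis using s by (simp add: mult.assoc)
  qed
  have e0: "w (t0 + \<epsilon>) x0 - w t0 x0 = s * \<psi> t0 * w t0 x0"
    using \<psi>0 wpos[OF t0(1,3)] by (simp add: s_def)
  \<comment> \<open>At \<open>t1\<close> the arch equals 1 and the logarithmic derivative is below
    \<open>s1\<close>, which makes \<open>s\<close> small. At the touching point the smallness of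
    \<open>s\<close> in turn bounds \<open>w1\<close> by
    \<open>4 * s1 * \<psi> t0 * w t0 x0\<close>.\<close>
  have "s * w t1 x1 \<le> 2 * \<epsilon> * w1 t1 x1"
    using le[of t1 x1] diff(2)[of t1 x1] mid t1 ab by auto
  also have "\<dots> < 2 * \<epsilon> * (s1 * w t1 x1)" using t1 \<epsilon> by simp
  finally have ss: "s < 2 * \<epsilon> * s1" using wpos[of t1 x1] t1 ab by simp
  have "\<epsilon> * w1 t0 x0 / 2 \<le> s * \<psi> t0 * w t0 x0" using diff(1)[OF t0] e0 by simp
  also have "\<dots> \<le> 2 * \<epsilon> * s1 * \<psi> t0 * w t0 x0"
    using ss \<psi>0 wpos[OF t0(1,3)] by (intro mult_right_mono) auto
  finally have w1le: "w1 t0 x0 \<le> 4 * s1 * \<psi> t0 * w t0 x0" using \<epsilon> by simp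
  have w1nn: "w1 t0 x0 \<ge> 0" using w1_pos[of t0 x0] p1 t0 ab by auto
  \<comment> \<open>The translate of \<open>w\<close> by \<open>\<epsilon>\<close> is touched from
    below by \<open>(1 + s * \<psi>) * w\<close>; the additive barrier is zero.\<close>
  have T: "0 \<le> c\<^sup>2 * (w (1 * t0 + \<epsilon>) x0 - (1 + s * \<psi> t0) * w t0 x0)
    - (exp (\<alpha> * (1 * t0 + \<epsilon>)) * w (1 * t0 + \<epsilon>) x0 powr p - (1 + s * \<psi> t0) * (exp (\<alpha> * t0) * w t0 x0 powr p))
    - (- (s * \<nu> * \<nu> * \<psi> t0)) * w t0 x0 - 2 * (s * \<nu> * cos (\<nu> * (t0 - a))) * w1 t0 x0 - 0"
  proof (rule touch[OF t0(3) t0', where g = "\<lambda>t. 1 + s * \<psi> t" and ?g1.0 = "\<lambda>t. s * \<nu> * cos (\<nu> * (t - a))"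
      and \<phi> = "\<lambda>_. 0" and ?\<phi>1.0 = "\<lambda>_. 0"])
    show "((\<lambda>t. 1 + s * \<psi> t) has_real_derivative s * \<nu> * cos (\<nu> * (t - a))) (at t)" for t
      unfolding \<psi>_def by (auto intro!: derivative_eq_intros)
    show "((\<lambda>t. s * \<nu> * cos (\<nu> * (t - a))) has_real_derivative - (s * \<nu> * \<nu> * \<psi> t0)) (at t0)"
      unfolding \<psi>_def by (auto intro!: derivative_eq_intros)
    fix t x assume "a < t" "t < b" "x \<in> K"
    then show "w (1 * t0 + \<epsilon>) x0 - (1 + s * \<psi> t0) * w t0 x0 - 0 \<le> w (1 * t + \<epsilon>) x - (1 + s * \<psi> t) * w t x - 0"
      using le[of t x] e0 by (simp add: algebra_simps)
  qed (use ab \<epsilon> in auto)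
  have e1: "w (t0 + \<epsilon>) x0 = (1 + s * \<psi> t0) * w t0 x0" using e0 by (simp add: algebra_simps)
  have e2: "w (t0 + \<epsilon>) x0 powr p = (1 + s * \<psi> t0) powr p * w t0 x0 powr p"
    unfolding e1 by (rule powr_mult)
  have "c\<^sup>2 * (w (1 * t0 + \<epsilon>) x0 - (1 + s * \<psi> t0) * w t0 x0) = 0" by (simp add: e1)
  with T have "0 \<le> - (w (t0 + \<epsilon>) x0 powr p - (1 + s * \<psi> t0) * w t0 x0 powr p)
     + s * \<nu> * \<nu> * \<psi> t0 * w t0 x0 - 2 * (s * \<nu> * cos (\<nu> * (t0 - a))) * w1 t0 x0"
    by (simp only: \<alpha>0 mult_zero_left exp_zero mult_1 mult_minus_left)
  then have "((1 + s * \<psi> t0) powr p - (1 + s * \<psi> t0)) * w t0 x0 powr p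
      \<le> s * \<nu> * \<nu> * \<psi> t0 * w t0 x0 - 2 * (s * \<nu> * cos (\<nu> * (t0 - a))) * w1 t0 x0"
    unfolding e2 left_diff_distrib by linarith
  \<comment> \<open>The cosine may have either sign, so its worst value \<open>-1\<close> is taken.
    The bound on \<open>w1\<close> carries a factor \<open>\<psi> t0\<close>, which matches the
    remaining terms.\<close>
  also have "\<dots> \<le> s * \<nu> * \<nu> * \<psi> t0 * w t0 x0 + 2 * (s * \<nu>) * (4 * s1 * \<psi> t0 * w t0 x0)"
  proof -
    have "- cos (\<nu> * (t0 - a)) * w1 t0 x0 \<le> 1 * (4 * s1 * \<psi> t0 * w t0 x0)"
      using w1nn w1le cos_ge_minus_one[of "\<nu> * (t0 - a)"] by (intro mult_mono) auto
    then have "2 * (s * \<nu>) * (- cos (\<nu> * (t0 - a)) * w1 t0 x0) \<le> 2 * (s * \<nu>) * (4 * s1 * \<psi> t0 * w t0 x0)"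
      using s \<nu> by (intro mult_left_mono) auto
    then show ?thesis by (simp add: algebra_simps)
  qed
  also have "\<dots> = (q\<^sup>2 / 2) * (s * \<psi> t0 * w t0 x0)"
    by (simp add: \<nu>_def s1_def power2_eq_square algebra_simps)
  finally have up: "((1 + s * \<psi> t0) powr p - (1 + s * \<psi> t0)) * w t0 x0 powr p \<le> (q\<^sup>2 / 2) * (s * \<psi> t0 * w t0 x0)" .
  \<comment> \<open>Convexity and \<open>w \<ge> \<delta>\<close> bound the left-hand side of
    \<open>up\<close> from below with the constant \<open>q\<^sup>2\<close>, twice the one in
    \<open>up\<close>.\<close>
  have "q\<^sup>2 * (s * \<psi> t0 * w t0 x0) = ((p - 1) * (s * \<psi> t0)) * (\<delta> powr (p - 1) * w t0 x0)"
    unfolding q(2) by (simp only: mult_ac)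
  also have "\<dots> \<le> ((p - 1) * (s * \<psi> t0)) * (w t0 x0 powr (p - 1) * w t0 x0)"
    using w\<delta>[of t0 x0] t0 ab \<delta> p1 s \<psi>0 wpos[OF t0(1,3)]
    by (intro mult_left_mono mult_right_mono powr_mono2) auto
  also have "\<dots> = ((p - 1) * (s * \<psi> t0)) * w t0 x0 powr p"
    using wpos[OF t0(1,3)] by (simp add: powr_diff)
  also have "\<dots> \<le> ((1 + s * \<psi> t0) powr p - (1 + s * \<psi> t0)) * w t0 x0 powr p"
    using powr_ge_tangent_at_1[of "1 + s * \<psi> t0" p] p1 s \<psi>0 by (intro mult_right_mono) auto
  finally have "q\<^sup>2 * (s * \<psi> t0 * w t0 x0) \<le> (q\<^sup>2 / 2) * (s * \<psi> t0 * w t0 x0)" using up by linarith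
  moreover have "q\<^sup>2 * (s * \<psi> t0 * w t0 x0) > 0" using q(1) s \<psi>0 wpos[OF t0(1,3)] by auto
  ultimately show False by linarith
qed

lemma contradiction: False
  using contradiction_sublinear contradiction_superlinear_subcritical contradiction_critical \<alpha>
  by (cases "p \<le> 1"; cases "\<alpha> = 0") auto

end

section \<open>Solutions in the exterior of the ball\<close>

text \<open>For \<open>i = j\<close> this is not a rotation.\<close>

definition plane_rotation :: "'n::finite \<Rightarrow> 'n \<Rightarrow> real \<Rightarrow> real^'n \<Rightarrow> real^'n" where
  "plane_rotation i j s x = x + ((cos s - 1) * x $ i - sin s * x $ j) *\<^sub>R axis i 1
     + ((cos s - 1) * x $ j + sin s * x $ i) *\<^sub>R axis j 1"

lemma plane_rotation_0 [simp]: "plane_rotation i j 0 x = x"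
  by (simp add: plane_rotation_def)

lemma plane_rotation_scaleR: "plane_rotation i j s (r *\<^sub>R x) = r *\<^sub>R plane_rotation i j s x"
  by (simp add: plane_rotation_def algebra_simps)

lemma norm_plane_rotation:
  assumes "i \<noteq> j"
  shows "norm (plane_rotation i j s x) = norm x"
proof -
  define A where "A = (cos s - 1) * x $ i - sin s * x $ j"
  define B where "B = (cos s - 1) * x $ j + sin s * x $ i"
  have "axis i (1::real) $ j = 0" "axis j (1::real) $ i = 0" using assms by (simp_all add: axis_def)
  then have "plane_rotation i j s x \<bullet> plane_rotation i j s x =
      ((A + x $ i)\<^sup>2 + (B + x $ j)\<^sup>2) + (x \<bullet> x - (x $ i)\<^sup>2 - (x $ j)\<^sup>2)"
    unfolding plane_rotation_def A_def[symmetric] B_def[symmetric]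
    by (simp add: inner_add_left inner_add_right inner_axis inner_axis' inner_axis_axis
        power2_eq_square algebra_simps)
  also have "(A + x $ i)\<^sup>2 + (B + x $ j)\<^sup>2 = ((cos s)\<^sup>2 + (sin s)\<^sup>2) * ((x $ i)\<^sup>2 + (x $ j)\<^sup>2)"
    unfolding A_def B_def by algebra
  finally show ?thesis by (simp add: norm_eq_sqrt_inner)
qed

lemma sum_axis_combination:
  fixes g :: "'n::finite \<Rightarrow> real"
  shows "(\<Sum>k\<in>UNIV. g k * (a *\<^sub>R axis i 1 + b *\<^sub>R axis j 1) $ k) = a * g i + b * g j"
proof -
  have "(\<Sum>k\<in>UNIV. g k * (a *\<^sub>R axis i 1 + b *\<^sub>R axis j 1) $ k)
      = (\<Sum>k\<in>UNIV. (if k = i then a * g k else 0) + (if k = j then b * g k else 0))"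
    by (intro sum.cong) (auto simp: axis_def algebra_simps)
  then show ?thesis by (simp add: sum.distrib)
qed

lemma has_vector_derivative_plane_rotation:
  "((\<lambda>s. plane_rotation i j s x) has_vector_derivative
     (- sin s * x $ i - cos s * x $ j) *\<^sub>R axis i 1 + (cos s * x $ i - sin s * x $ j) *\<^sub>R axis j 1) (at s)"
  unfolding plane_rotation_def
  by (auto intro!: derivative_eq_intros simp: algebra_simps)

lemma chain_partials:
  fixes f :: "real^'n::finite \<Rightarrow> real"
  assumes "(f has_derivative (\<lambda>v. \<Sum>i\<in>UNIV. g i * v $ i)) (at (\<gamma> s))"
    and "(\<gamma> has_vector_derivative v) (at s)"
  shows "((\<lambda>s. f (\<gamma> s)) has_real_derivative (\<Sum>i\<in>UNIV. g i * v $ i)) (at s)"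
proof -
  have "((\<lambda>s. f (\<gamma> s)) has_derivative (\<lambda>h. \<Sum>i\<in>UNIV. g i * (h *\<^sub>R v) $ i)) (at s)"
    using has_derivative_compose[OF assms(2)[unfolded has_vector_derivative_def] assms(1)] .
  moreover have "(\<lambda>h. \<Sum>i\<in>UNIV. g i * (h *\<^sub>R v) $ i) = (*) (\<Sum>i\<in>UNIV. g i * v $ i)"
    by (auto simp: sum_distrib_left algebra_simps)
  ultimately show ?thesis by (simp add: has_field_derivative_def)
qed

text \<open>\<open>G\<close> and \<open>H\<close> stand for the first and second partial derivatives
  of \<open>u\<close>. The assumption \<open>pde\<close> is the expanded divergence form divided by
  the weight \<open>|x|^\<theta>\<close>, so its right-hand side carries the exponent
  \<open>\<tau> = l - \<theta>\<close>.\<close>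

locale exterior_solution =
  fixes u :: "real^'n::finite \<Rightarrow> real" and G :: "'n \<Rightarrow> real^'n \<Rightarrow> real" and H :: "'n \<Rightarrow> 'n \<Rightarrow> real^'n \<Rightarrow> real"
    and \<theta> \<tau> p :: real
  assumes cont_u: "continuous_on (- ball 0 1) u"
    and boundary: "norm x = 1 \<Longrightarrow> u x = 0"
    and nonneg: "norm x \<ge> 1 \<Longrightarrow> u x \<ge> 0"
    and G: "norm x > 1 \<Longrightarrow> (u has_derivative (\<lambda>v. \<Sum>i\<in>UNIV. G i x * v $ i)) (at x)"
    and H: "norm x > 1 \<Longrightarrow> (G i has_derivative (\<lambda>v. \<Sum>j\<in>UNIV. H i j x * v $ j)) (at x)"
    and pde: "norm x > 1 \<Longrightarrow> (\<Sum>i\<in>UNIV. H i i x) + \<theta> * (\<Sum>i\<in>UNIV. x $ i * G i x) / (norm x)\<^sup>2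
      = - (norm x powr \<tau> * u x powr p)"
begin

section \<open>Strong maximum principle and positivity along rays\<close>

lemma isCont_u: "norm x > 1 \<Longrightarrow> isCont u x"
  using G has_derivative_continuous by blast

lemma isCont_G: "norm x > 1 \<Longrightarrow> isCont (G i) x"
  using H has_derivative_continuous by blast

text \<open>The strong maximum principle, by the barrier \<open>exp (- a \<bar>x - y\<bar>\<^sup>2) - exp (- a \<rho>\<^sup>2)\<close> on an annulus.\<close>

lemma positive_on_ball:
  assumes \<rho>: "cball y \<rho> \<subseteq> {x. norm x > 1}" and y: "u y > 0" and z: "dist y z < \<rho>"
  shows "u z > 0"
proof -
  have \<rho>0: "\<rho> > 0" using z zero_le_dist[of y z] by linarith
  then have y1: "norm y > 1" using subsetD[OF \<rho>, of y] by simp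
  obtain d where d: "d > 0" "\<And>x. dist x y < d \<Longrightarrow> dist (u x) (u y) < u y / 2"
    using isCont_u[OF y1] y unfolding continuous_at_eps_delta by (meson half_gt_zero)
  define \<epsilon> where "\<epsilon> = u y / 2"
  define r where "r = min d \<rho> / 2"
  have r: "r > 0" "r < d" "r < \<rho>" using d \<rho>0 by (auto simp: r_def)
  have \<epsilon>: "\<epsilon> > 0" using y by (simp add: \<epsilon>_def)
  have near: "u x > \<epsilon>" if "dist y x \<le> r" for x
    using d(2)[of x] that r by (auto simp: dist_commute dist_real_def \<epsilon>_def abs_if split: if_splits)
  show ?thesis
  proof (cases "dist y z \<le> r")
    case True
    then show ?thesis using near[OF True] \<epsilon> by simp
  next
    case False
    define N where "N = real CARD('n)"
    \<comment> \<open>Large enough to make the barrier a strict subsolution on the annulus: up to a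
      common positive factor, the Laplacian contributes at least
      \<open>2 * a * r\<^sup>2 - N\<close> and the drift at least
      \<open>- \<bar>\<theta>\<bar> * \<rho>\<close>.\<close>
    define a where "a = (N + \<bar>\<theta>\<bar> * \<rho> + 1) / r\<^sup>2"
    have a: "a > 0" "a * r\<^sup>2 > N + \<bar>\<theta>\<bar> * \<rho>" using r \<rho>0 by (auto simp: a_def N_def add_nonneg_pos)
    define B where "B x = exp (- a * (dist y x)\<^sup>2) - exp (- a * \<rho>\<^sup>2)" for x
    define A where "A = cball y \<rho> - ball y r"
    have A: "compact A" "z \<in> A"
      using False z by (auto simp: A_def intro!: compact_diff)
    have "continuous_on A (\<lambda>x. u x - \<epsilon> * B x)"
      unfolding B_def using \<rho> by (intro continuous_intros continuous_at_imp_continuous_on ballI isCont_u)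
        (auto simp: A_def)
    then obtain x0 where x0: "x0 \<in> A" and inf: "\<And>x. x \<in> A \<Longrightarrow> u x0 - \<epsilon> * B x0 \<le> u x - \<epsilon> * B x"
      using continuous_attains_inf[of A "\<lambda>x. u x - \<epsilon> * B x"] A by blast
    have n0: "norm x0 > 1" using x0 \<rho> by (auto simp: A_def)
    have "u x0 - \<epsilon> * B x0 \<ge> 0"
    proof (rule ccontr)
      assume neg: "\<not> ?thesis"
      have "B x0 \<le> 1" by (simp add: B_def) (smt (verit) a(1) exp_gt_zero mult_nonneg_nonneg one_le_exp_iff zero_le_power2 exp_le_one_iff)
      \<comment> \<open>A negative minimum avoids both boundary spheres: on the inner one
        \<open>u > \<epsilon>\<close> and \<open>B \<le> 1\<close>, on the outer one
        \<open>u \<ge> 0\<close> and \<open>B = 0\<close>.\<close>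
      have "dist y x0 \<noteq> r"
      proof
        assume "dist y x0 = r"
        then have "u x0 > \<epsilon>" by (intro near) simp
        moreover have "\<epsilon> * B x0 \<le> \<epsilon> * 1" using \<epsilon> \<open>B x0 \<le> 1\<close> by (intro mult_left_mono) auto
        ultimately show False using neg by simp
      qed
      moreover have "dist y x0 \<noteq> \<rho>" using neg nonneg[of x0] n0 by (auto simp: B_def)
      ultimately have x0': "r < dist y x0" "dist y x0 < \<rho>" using x0 by (auto simp: A_def)
      define v where "v = x0 - y"
      have dv: "dist y x0 = norm v" by (simp add: v_def dist_norm norm_minus_commute)
      define E where "E = exp (- a * (norm v)\<^sup>2)"
      have E: "E > 0" by (simp add: E_def)
      have "open (ball y \<rho> - cball y r)" "x0 \<in> ball y \<rho> - cball y r" using x0' by auto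
      then obtain h where h: "h > 0" "ball x0 h \<subseteq> ball y \<rho> - cball y r"
        using open_contains_ball by metis
      \<comment> \<open>The one-variable test is applied on each coordinate line through
        \<open>x0\<close>, along which the squared distance to \<open>y\<close> is a quadratic
        polynomial.\<close>
      have GH: "G i x0 = - 2 * a * \<epsilon> * E * v $ i"
        "H i i x0 \<ge> \<epsilon> * E * (4 * a\<^sup>2 * (v $ i)\<^sup>2 - 2 * a)" for i
      proof -
        define \<gamma> where "\<gamma> s = x0 + s *\<^sub>R axis i 1" for s :: real
        have \<gamma>A: "\<gamma> s \<in> A" if "- h < s" "s < h" for s
        proof -
          have "dist x0 (\<gamma> s) < h" using that by (simp add: \<gamma>_def dist_norm)
          then show ?thesis using h by (force simp: A_def)
        qed
        have \<gamma>1: "norm (\<gamma> s) > 1" if "- h < s" "s < h" for s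
          using \<gamma>A[OF that] \<rho> by (auto simp: A_def)
        have \<gamma>': "(\<gamma> has_vector_derivative axis i 1) (at s)" for s
          unfolding \<gamma>_def by (auto intro!: derivative_eq_intros)
        have sel: "(\<Sum>k\<in>UNIV. f k * axis i 1 $ k) = f i" for f :: "'n \<Rightarrow> real"
          using sum_axis_combination[of f 1 i 0 i] by simp
        have G\<gamma>: "((\<lambda>s. u (\<gamma> s)) has_real_derivative G i (\<gamma> s)) (at s)" if "- h < s" "s < h" for s
          using chain_partials[of u "\<lambda>i. G i (\<gamma> s)" \<gamma> s, OF G[OF \<gamma>1[OF that]] \<gamma>'] by (simp add: sel)
        have "((\<lambda>s. G i (\<gamma> s)) has_real_derivative H i i (\<gamma> 0)) (at 0)"
          using chain_partials[of "G i" "\<lambda>j. H i j (\<gamma> 0)" \<gamma> 0, OF H[OF \<gamma>1] \<gamma>'] h by (simp add: sel)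
        then have H\<gamma>: "((\<lambda>s. G i (\<gamma> s)) has_real_derivative H i i x0) (at 0)"
          by (simp add: \<gamma>_def)
        have q: "(dist y (\<gamma> s))\<^sup>2 = (norm v)\<^sup>2 + 2 * s * v $ i + s\<^sup>2" for s
        proof -
          have "(dist y (\<gamma> s))\<^sup>2 = (v + s *\<^sub>R axis i 1) \<bullet> (v + s *\<^sub>R axis i 1)"
            by (simp add: \<gamma>_def v_def dist_norm norm_minus_commute power2_norm_eq_inner algebra_simps)
          also have "\<dots> = (norm v)\<^sup>2 + 2 * s * v $ i + s\<^sup>2"
            unfolding power2_norm_eq_inner
            by (simp add: inner_add_left inner_add_right inner_axis inner_axis' inner_axis_axis
                power2_eq_square algebra_simps)
          finally show ?thesis .
        qed
        define F where "F s = - a * (2 * v $ i + 2 * s) * exp (- a * ((norm v)\<^sup>2 + 2 * s * v $ i + s\<^sup>2))" for s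
        have "u (\<gamma> 0) - \<epsilon> * B (\<gamma> 0) \<le> u (\<gamma> s) - \<epsilon> * B (\<gamma> s)" if "- h < s" "s < h" for s
          using inf[OF \<gamma>A[OF that]] by (simp add: \<gamma>_def)
        moreover have "((\<lambda>s. u (\<gamma> s) - \<epsilon> * B (\<gamma> s)) has_real_derivative G i (\<gamma> s) - \<epsilon> * F s) (at s)"
          if "- h < s" "s < h" for s
          unfolding B_def q F_def by (auto intro!: derivative_eq_intros G\<gamma> that simp: algebra_simps)
        moreover have "((\<lambda>s. G i (\<gamma> s) - \<epsilon> * F s) has_real_derivative
            H i i x0 - \<epsilon> * (E * (4 * a\<^sup>2 * (v $ i)\<^sup>2 - 2 * a))) (at 0)"
          unfolding F_def E_def
          by (auto intro!: derivative_eq_intros H\<gamma> simp: algebra_simps power2_eq_square)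
        moreover have "- h < 0" "0 < h" using h by auto
        ultimately have "G i (\<gamma> 0) - \<epsilon> * F 0 = 0" "0 \<le> H i i x0 - \<epsilon> * (E * (4 * a\<^sup>2 * (v $ i)\<^sup>2 - 2 * a))"
          using derivatives_at_interior_min[of "- h" 0 h "\<lambda>s. u (\<gamma> s) - \<epsilon> * B (\<gamma> s)" "\<lambda>s. G i (\<gamma> s) - \<epsilon> * F s"]
          by blast+
        then show "G i x0 = - 2 * a * \<epsilon> * E * v $ i"
          "H i i x0 \<ge> \<epsilon> * E * (4 * a\<^sup>2 * (v $ i)\<^sup>2 - 2 * a)"
          by (simp_all add: \<gamma>_def F_def E_def algebra_simps)
      qed
      have n2: "(\<Sum>i\<in>UNIV. (v $ i)\<^sup>2) = (norm v)\<^sup>2"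
        unfolding power2_norm_eq_inner by (simp add: inner_vec_def power2_eq_square)
      have "\<epsilon> * E * (4 * a\<^sup>2 * (norm v)\<^sup>2 - 2 * a * N) = (\<Sum>i\<in>UNIV. \<epsilon> * E * (4 * a\<^sup>2 * (v $ i)\<^sup>2 - 2 * a))"
        by (simp add: sum_distrib_left[symmetric] sum_subtractf n2 N_def algebra_simps)
      also have "\<dots> \<le> (\<Sum>i\<in>UNIV. H i i x0)" by (intro sum_mono GH)
      finally have trH: "\<epsilon> * E * (4 * a\<^sup>2 * (norm v)\<^sup>2 - 2 * a * N) \<le> (\<Sum>i\<in>UNIV. H i i x0)" .
      have xG: "(\<Sum>i\<in>UNIV. x0 $ i * G i x0) = - (2 * a * \<epsilon> * E) * (x0 \<bullet> v)"
        by (simp add: GH inner_vec_def sum_distrib_left algebra_simps)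
      have "\<bar>\<theta> * (x0 \<bullet> v) / (norm x0)\<^sup>2\<bar> \<le> \<bar>\<theta>\<bar> * \<rho>"
      proof -
        have "\<bar>x0 \<bullet> v\<bar> \<le> norm x0 * norm v" by (rule Cauchy_Schwarz_ineq2)
        \<comment> \<open>Since \<open>norm x0 > 1\<close>, one more factor \<open>norm x0\<close>
          is allowed, and the division by its square leaves a bound independent of
          \<open>x0\<close>.\<close>
        also have "\<dots> \<le> (norm x0)\<^sup>2 * \<rho>"
          using x0' dv n0 by (intro mult_mono) (auto simp: power2_eq_square mult_le_cancel_left1)
        finally have "\<bar>\<theta>\<bar> * \<bar>x0 \<bullet> v\<bar> \<le> \<bar>\<theta>\<bar> * ((norm x0)\<^sup>2 * \<rho>)" by (intro mult_left_mono) auto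
        moreover have "(norm x0)\<^sup>2 > 0" using n0 by (intro zero_less_power) linarith
        ultimately show ?thesis by (simp only: abs_mult abs_divide abs_power2 pos_divide_le_eq mult_ac)
      qed
      then have "2 * a * \<epsilon> * E * (\<theta> * (x0 \<bullet> v) / (norm x0)\<^sup>2) \<le> 2 * a * \<epsilon> * E * (\<bar>\<theta>\<bar> * \<rho>)"
        using a \<epsilon> E by (intro mult_left_mono[OF abs_le_D1]) simp_all
      then have "\<theta> * (\<Sum>i\<in>UNIV. x0 $ i * G i x0) / (norm x0)\<^sup>2 \<ge> - (2 * a * \<epsilon> * E * (\<bar>\<theta>\<bar> * \<rho>))"
        unfolding xG by (simp add: algebra_simps)
      with trH pde[OF n0] have "\<epsilon> * E * (4 * a\<^sup>2 * (norm v)\<^sup>2 - 2 * a * N) - 2 * a * \<epsilon> * E * (\<bar>\<theta>\<bar> * \<rho>) \<le> 0"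
        using powr_ge_zero[of "norm x0" \<tau>] powr_ge_zero[of "u x0" p]
        by (smt (verit) mult_nonneg_nonneg)
      then have "(2 * a * \<epsilon> * E) * (2 * a * (norm v)\<^sup>2 - N - \<bar>\<theta>\<bar> * \<rho>) \<le> 0"
        by (simp add: algebra_simps power2_eq_square)
      moreover have "2 * a * (norm v)\<^sup>2 - N - \<bar>\<theta>\<bar> * \<rho> > 0"
      proof -
        have "r\<^sup>2 \<le> (norm v)\<^sup>2" using x0' dv r by (intro power_mono) auto
        then have "a * r\<^sup>2 \<le> a * (norm v)\<^sup>2" "a * (norm v)\<^sup>2 \<ge> 0" using a by auto
        then show ?thesis using a by linarith
      qed
      ultimately show False using a \<epsilon> E by (simp add: mult_le_0_iff)
    qed
    then have "\<epsilon> * B z \<le> u z" using inf[OF A(2)] by simp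
    moreover have "B z > 0"
    proof -
      have "(dist y z)\<^sup>2 < \<rho>\<^sup>2" using z by (intro power_strict_mono) auto
      then show ?thesis using a by (simp add: B_def)
    qed
    ultimately show ?thesis using \<epsilon> mult_pos_pos[of \<epsilon> "B z"] by linarith
  qed
qed

text \<open>With a third of the distance from \<open>x\<close> to the unit sphere as radius, the
  ball around a nearby point of positivity contains \<open>x\<close> and stays in the
  exterior.\<close>

lemma positive_if_closure:
  assumes x: "norm x > 1" "x \<in> closure {x. norm x > 1 \<and> u x > 0}"
  shows "u x > 0"
proof -
  define \<rho> where "\<rho> = (norm x - 1) / 3"
  have \<rho>: "\<rho> > 0" using x by (simp add: \<rho>_def)
  obtain y where y: "u y > 0" "dist y x < \<rho>"
    using x(2) \<rho> unfolding closure_approachable by blast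
  show ?thesis
  proof (rule positive_on_ball[OF _ y])
    show "cball y \<rho> \<subseteq> {x. norm x > 1}"
    proof safe
      fix z assume "z \<in> cball y \<rho>"
      then have "dist z x < 2 * \<rho>" using y(2) dist_triangle[of z x y] by (auto simp: dist_commute)
      then have "norm x - norm z < 2 * \<rho>" using norm_triangle_ineq2[of x z]
        by (simp add: dist_norm norm_minus_commute)
      then show "norm z > 1" using x by (simp add: \<rho>_def)
    qed
  qed
qed

text \<open>Positivity is open along the ray by continuity, closed by
  \<open>positive_if_closure\<close>, and the ray is connected.\<close>

lemma positive_on_ray:
  assumes x: "norm x = 1" and r: "r > 1" "u (r *\<^sub>R x) > 0" and s: "s > 1"
  shows "u (s *\<^sub>R x) > 0"
proof -
  define A where "A = {r. r > 1 \<and> u (r *\<^sub>R x) > 0}"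
  have "A = {1<..} \<inter> (\<lambda>r. r *\<^sub>R x) -` closure {x. norm x > 1 \<and> u x > 0}"
  proof (intro equalityI subsetI)
    fix r assume "r \<in> A"
    then show "r \<in> {1<..} \<inter> (\<lambda>r. r *\<^sub>R x) -` closure {x. norm x > 1 \<and> u x > 0}"
      using x closure_subset by (force simp: A_def)
  next
    fix r assume "r \<in> {1<..} \<inter> (\<lambda>r. r *\<^sub>R x) -` closure {x. norm x > 1 \<and> u x > 0}"
    then show "r \<in> A" using x by (auto simp: A_def intro!: positive_if_closure)
  qed
  then have "closedin (top_of_set {1<..}) A"
    by (auto intro!: continuous_closedin_preimage continuous_intros)
  moreover have "openin (top_of_set {1<..}) A"
  proof -
    have "A = {1<..} \<inter> (\<lambda>r. u (r *\<^sub>R x)) -` {0<..}" by (auto simp: A_def)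
    moreover have "continuous_on {1<..} (\<lambda>r. u (r *\<^sub>R x))"
      by (rule continuous_on_compose2[OF cont_u]) (auto intro!: continuous_intros simp: x)
    ultimately show ?thesis by (auto intro!: continuous_openin_preimage_gen)
  qed
  moreover have "connected {1::real<..}" by simp
  ultimately have "A = {} \<or> A = {1<..}" unfolding connected_clopen by blast
  moreover have "r \<in> A" using r by (simp add: A_def)
  ultimately have "s \<in> A" using s by auto
  then show ?thesis by (simp add: A_def)
qed

text \<open>\<open>rot2 i j\<close> is the second derivative of \<open>u\<close> along the rotation in the \<open>(i, j)\<close>-plane; the Laplacian of the
sphere is their sum over \<open>i < j\<close>.\<close>

definition "D1 y = (\<Sum>i\<in>UNIV. G i y * y $ i)"
definition "D2 y = (\<Sum>i\<in>UNIV. (\<Sum>j\<in>UNIV. H i j y * y $ j) * y $ i)"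
definition "rot2 i j y = (if i = j then 0 else (y $ i)\<^sup>2 * H j j y + (y $ j)\<^sup>2 * H i i y
  - y $ i * y $ j * (H i j y + H j i y) - y $ i * G i y - y $ j * G j y)"
definition "sphere_laplacian y = (\<Sum>i\<in>UNIV. \<Sum>j\<in>UNIV. rot2 i j y) / 2"

section \<open>The spherical Laplacian and its sign at a minimum\<close>

text \<open>The Laplacian in polar coordinates: \<open>D1\<close> is \<open>r u_r\<close> and
  \<open>D2\<close> is \<open>r\<^sup>2 u_rr\<close>.\<close>

lemma sphere_laplacian_eq:
  "sphere_laplacian y = (norm y)\<^sup>2 * (\<Sum>i\<in>UNIV. H i i y) - D2 y - (real CARD('n) - 1) * D1 y"
proof -
  have n2: "(\<Sum>i\<in>UNIV. (y $ i)\<^sup>2) = (norm y)\<^sup>2"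
    unfolding power2_norm_eq_inner by (simp add: inner_vec_def power2_eq_square)
  \<comment> \<open>On the diagonal the generic formula gives \<open>- 2 * G i y * y $ i\<close>
    instead of 0; the last term corrects this and accounts for the \<open>- 1\<close> in the
    coefficient of \<open>D1\<close>.\<close>
  have "rot2 i j y = ((y $ i)\<^sup>2 * H j j y + H i i y * (y $ j)\<^sup>2)
      - (H i j y * y $ j * y $ i + H j i y * y $ i * y $ j) - (G i y * y $ i + G j y * y $ j)
      + (if i = j then G i y * y $ i + G i y * y $ i else 0)" for i j
    by (auto simp: rot2_def power2_eq_square algebra_simps)
  then have "(\<Sum>i\<in>UNIV. \<Sum>j\<in>UNIV. rot2 i j y) =
      ((\<Sum>i\<in>UNIV. \<Sum>j\<in>UNIV. (y $ i)\<^sup>2 * H j j y) + (\<Sum>i\<in>UNIV. \<Sum>j\<in>UNIV. H i i y * (y $ j)\<^sup>2))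
      - ((\<Sum>i\<in>UNIV. \<Sum>j\<in>UNIV. H i j y * y $ j * y $ i) + (\<Sum>i\<in>UNIV. \<Sum>j\<in>UNIV. H j i y * y $ i * y $ j))
      - ((\<Sum>i\<in>UNIV. \<Sum>j\<in>(UNIV::'n set). G i y * y $ i) + (\<Sum>i\<in>(UNIV::'n set). \<Sum>j\<in>UNIV. G j y * y $ j))
      + (\<Sum>i\<in>UNIV. \<Sum>j\<in>UNIV. if i = j then G i y * y $ i + G i y * y $ i else 0)"
    by (simp only: sum.distrib sum_subtractf)
  also have "(\<Sum>i\<in>UNIV. \<Sum>j\<in>UNIV. (y $ i)\<^sup>2 * H j j y) = (norm y)\<^sup>2 * (\<Sum>i\<in>UNIV. H i i y)"
    by (simp add: sum_product n2[symmetric])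
  also have "(\<Sum>i\<in>UNIV. \<Sum>j\<in>UNIV. H i i y * (y $ j)\<^sup>2) = (norm y)\<^sup>2 * (\<Sum>i\<in>UNIV. H i i y)"
    by (simp add: sum_product n2[symmetric] mult.commute)
  also have "(\<Sum>i\<in>UNIV. \<Sum>j\<in>UNIV. H i j y * y $ j * y $ i) = D2 y"
    by (simp add: D2_def sum_distrib_right)
  also have "(\<Sum>i\<in>UNIV. \<Sum>j\<in>UNIV. H j i y * y $ i * y $ j) = D2 y"
    by (subst sum.swap) (simp add: D2_def sum_distrib_right)
  also have "(\<Sum>i\<in>UNIV. \<Sum>j\<in>(UNIV::'n set). G i y * y $ i) = real CARD('n) * D1 y"
    by (simp add: D1_def sum_distrib_left)
  also have "(\<Sum>i\<in>(UNIV::'n set). \<Sum>j\<in>UNIV. G j y * y $ j) = real CARD('n) * D1 y"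
    by (simp add: D1_def)
  also have "(\<Sum>i\<in>UNIV. \<Sum>j\<in>UNIV. if i = j then G i y * y $ i + G i y * y $ i else 0) = 2 * D1 y"
    by (simp add: D1_def sum_distrib_left mult_ac)
  finally show ?thesis by (simp add: sphere_laplacian_def field_simps)
qed

lemma rotation_derivatives:
  assumes ij: "i \<noteq> j" and y: "norm y > 1"
  shows "((\<lambda>s. u (plane_rotation i j s y)) has_real_derivative
      (- sin s * y $ i - cos s * y $ j) * G i (plane_rotation i j s y)
      + (cos s * y $ i - sin s * y $ j) * G j (plane_rotation i j s y)) (at s)"
    and "((\<lambda>s. (- sin s * y $ i - cos s * y $ j) * G i (plane_rotation i j s y)
      + (cos s * y $ i - sin s * y $ j) * G j (plane_rotation i j s y)) has_real_derivative rot2 i j y) (at 0)"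
proof -
  have n: "norm (plane_rotation i j s y) > 1" for s using y norm_plane_rotation[OF ij] by simp
  show "((\<lambda>s. u (plane_rotation i j s y)) has_real_derivative
      (- sin s * y $ i - cos s * y $ j) * G i (plane_rotation i j s y)
      + (cos s * y $ i - sin s * y $ j) * G j (plane_rotation i j s y)) (at s)"
    using chain_partials[OF G[OF n] has_vector_derivative_plane_rotation]
    unfolding sum_axis_combination .
  have g: "((\<lambda>s. G k (plane_rotation i j s y)) has_real_derivative - y $ j * H k i y + y $ i * H k j y) (at 0)" for k
  proof -
    have "((\<lambda>s. G k (plane_rotation i j s y)) has_real_derivative
        (- sin 0 * y $ i - cos 0 * y $ j) * H k i (plane_rotation i j 0 y)
        + (cos 0 * y $ i - sin 0 * y $ j) * H k j (plane_rotation i j 0 y)) (at 0)"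
      using chain_partials[OF H[OF n] has_vector_derivative_plane_rotation]
      unfolding sum_axis_combination .
    then show ?thesis by simp
  qed
  show "((\<lambda>s. (- sin s * y $ i - cos s * y $ j) * G i (plane_rotation i j s y)
      + (cos s * y $ i - sin s * y $ j) * G j (plane_rotation i j s y)) has_real_derivative rot2 i j y) (at 0)"
    using ij by (auto intro!: derivative_eq_intros g simp: rot2_def power2_eq_square algebra_simps)
qed

text \<open>Positivity on one sphere propagates along rays, so \<open>K\<close> is clopen in the unit sphere. This replaces the
connectedness of the exterior domain, which fails for \<open>N = 1\<close>.\<close>

definition "K = {x. norm x = 1 \<and> u (2 *\<^sub>R x) > 0}"

lemma compact_K: "compact K"
proof -
  have "K = sphere 0 1 \<inter> (\<lambda>x. 2 *\<^sub>R x) -` closure {x. norm x > 1 \<and> u x > 0}"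
  proof (intro equalityI subsetI)
    fix x assume "x \<in> K"
    then show "x \<in> sphere 0 1 \<inter> (\<lambda>x. 2 *\<^sub>R x) -` closure {x. norm x > 1 \<and> u x > 0}"
      using closure_subset by (force simp: K_def)
  next
    fix x assume "x \<in> sphere 0 1 \<inter> (\<lambda>x. 2 *\<^sub>R x) -` closure {x. norm x > 1 \<and> u x > 0}"
    then show "x \<in> K" by (auto simp: K_def intro!: positive_if_closure)
  qed
  moreover have "closed ((\<lambda>x. 2 *\<^sub>R x) -` closure {x. norm x > 1 \<and> u x > 0})"
    by (intro continuous_closed_vimage) (auto intro!: continuous_intros)
  ultimately show ?thesis by (simp add: compact_Int_closed)
qed

lemma K_pos: "x \<in> K \<Longrightarrow> r > 1 \<Longrightarrow> u (r *\<^sub>R x) > 0"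
  using positive_on_ray[of x 2 r] by (auto simp: K_def)

text \<open>\<open>K\<close> is defined by positivity of \<open>u\<close> on the sphere of radius 2,
  which continuity preserves under small rotations.\<close>

lemma rotation_in_K:
  assumes ij: "i \<noteq> j" and x: "x \<in> K"
  obtains d where "d > 0" "\<And>s. - d < s \<Longrightarrow> s < d \<Longrightarrow> plane_rotation i j s x \<in> K"
proof -
  define f where "f s = u (plane_rotation i j s (2 *\<^sub>R x))" for s
  have x1: "norm x = 1" "u (2 *\<^sub>R x) > 0" using x by (auto simp: K_def)
  have "isCont f 0"
    unfolding f_def using x1 by (intro DERIV_isCont[OF rotation_derivatives(1)[OF ij]]) simp
  moreover have "f 0 > 0" using x1 by (simp add: f_def)
  ultimately obtain d where d: "d > 0" "\<And>s. dist s 0 < d \<Longrightarrow> dist (f s) (f 0) < f 0"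
    unfolding continuous_at_eps_delta by meson
  have "f s > 0" if "- d < s" "s < d" for s
  proof -
    have "\<bar>f s - f 0\<bar> < f 0" using d(2)[of s] that by (auto simp: dist_real_def)
    then show ?thesis by linarith
  qed
  then show ?thesis
    using d(1) that x1 norm_plane_rotation[OF ij] by (auto simp: f_def K_def plane_rotation_scaleR)
qed

text \<open>Small rotations of \<open>x0\<close> stay in \<open>K\<close>, so the second derivative
  along each of them is nonnegative at the minimum, and these are summed. The factors
  \<open>A'\<close> and \<open>A\<close> take up the exponentials of the cylinder variables.\<close>

lemma sphere_laplacian_min:
  assumes t: "t > 0" "t' > 0" and x0: "x0 \<in> K"
    and min: "\<And>x. x \<in> K \<Longrightarrow> A' * u (exp t' *\<^sub>R x0) - A * u (exp t *\<^sub>R x0) \<le> A' * u (exp t' *\<^sub>R x) - A * u (exp t *\<^sub>R x)"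
  shows "0 \<le> A' * sphere_laplacian (exp t' *\<^sub>R x0) - A * sphere_laplacian (exp t *\<^sub>R x0)"
proof -
  define y where "y = exp t *\<^sub>R x0"
  define y' where "y' = exp t' *\<^sub>R x0"
  have n: "norm y > 1" "norm y' > 1" using t x0 by (auto simp: y_def y'_def K_def)
  have "0 \<le> A' * rot2 i j y' - A * rot2 i j y" for i j
  proof (cases "i = j")
    case False
    obtain d where d: "d > 0" "\<And>s. - d < s \<Longrightarrow> s < d \<Longrightarrow> plane_rotation i j s x0 \<in> K"
      using rotation_in_K[OF False x0] by blast
    note * = rotation_derivatives[OF False n(1)] rotation_derivatives[OF False n(2)]
    show ?thesis
    proof (rule derivatives_at_interior_min(2)[of "- d" 0 d
        "\<lambda>s. A' * u (plane_rotation i j s y') - A * u (plane_rotation i j s y)"])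
      fix s assume "- d < s" "s < d"
      then show "A' * u (plane_rotation i j 0 y') - A * u (plane_rotation i j 0 y)
        \<le> A' * u (plane_rotation i j s y') - A * u (plane_rotation i j s y)"
        using min[OF d(2)] by (simp add: y_def y'_def plane_rotation_scaleR)
      show "((\<lambda>s. A' * u (plane_rotation i j s y') - A * u (plane_rotation i j s y)) has_real_derivative
          A' * ((- sin s * y' $ i - cos s * y' $ j) * G i (plane_rotation i j s y')
            + (cos s * y' $ i - sin s * y' $ j) * G j (plane_rotation i j s y'))
          - A * ((- sin s * y $ i - cos s * y $ j) * G i (plane_rotation i j s y)
            + (cos s * y $ i - sin s * y $ j) * G j (plane_rotation i j s y))) (at s)"
        by (intro DERIV_diff DERIV_cmult *)
    next
      show "((\<lambda>s. A' * ((- sin s * y' $ i - cos s * y' $ j) * G i (plane_rotation i j s y')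
            + (cos s * y' $ i - sin s * y' $ j) * G j (plane_rotation i j s y'))
          - A * ((- sin s * y $ i - cos s * y $ j) * G i (plane_rotation i j s y)
            + (cos s * y $ i - sin s * y $ j) * G j (plane_rotation i j s y))) has_real_derivative
          A' * rot2 i j y' - A * rot2 i j y) (at 0)"
        by (intro DERIV_diff DERIV_cmult *)
    qed (use d in auto)
  qed (simp add: rot2_def)
  then have "0 \<le> (\<Sum>i\<in>UNIV. \<Sum>j\<in>UNIV. A' * rot2 i j y' - A * rot2 i j y)"
    by (intro sum_nonneg) auto
  then show ?thesis
    by (simp add: sphere_laplacian_def y_def y'_def sum_subtractf sum_distrib_left[symmetric])
qed

section \<open>Passage to the half-cylinder\<close>

text \<open>The Emden-Fowler transform and its first two derivatives in \<open>t\<close>. Along a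
  ray the derivative of \<open>D1\<close> is \<open>D2 + D1\<close>, hence the coefficient
  \<open>2 * c + 1\<close>.\<close>

definition "cyl c t x = exp (c * t) * u (exp t *\<^sub>R x)"
definition "cyl1 c t x = exp (c * t) * (c * u (exp t *\<^sub>R x) + D1 (exp t *\<^sub>R x))"
definition "cyl2 c t x = exp (c * t) * (c\<^sup>2 * u (exp t *\<^sub>R x) + (2 * c + 1) * D1 (exp t *\<^sub>R x) + D2 (exp t *\<^sub>R x))"

lemma has_vector_derivative_exp_ray: "((\<lambda>t. exp t *\<^sub>R x) has_vector_derivative exp t *\<^sub>R x) (at t)"
  by (auto intro!: derivative_eq_intros)

lemma radial_derivatives:
  assumes "t > 0" "norm x = 1"
  shows "((\<lambda>t. u (exp t *\<^sub>R x)) has_real_derivative D1 (exp t *\<^sub>R x)) (at t)"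
    and "((\<lambda>t. D1 (exp t *\<^sub>R x)) has_real_derivative D2 (exp t *\<^sub>R x) + D1 (exp t *\<^sub>R x)) (at t)"
proof -
  have n: "norm (exp t *\<^sub>R x) > 1" using assms by simp
  show "((\<lambda>t. u (exp t *\<^sub>R x)) has_real_derivative D1 (exp t *\<^sub>R x)) (at t)"
    unfolding D1_def by (rule chain_partials[OF G[OF n] has_vector_derivative_exp_ray])
  have g: "((\<lambda>t. G i (exp t *\<^sub>R x)) has_real_derivative (\<Sum>j\<in>UNIV. H i j (exp t *\<^sub>R x) * (exp t *\<^sub>R x) $ j)) (at t)" for i
    by (rule chain_partials[OF H[OF n] has_vector_derivative_exp_ray])
  show "((\<lambda>t. D1 (exp t *\<^sub>R x)) has_real_derivative D2 (exp t *\<^sub>R x) + D1 (exp t *\<^sub>R x)) (at t)"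
    unfolding D1_def D2_def sum.distrib[symmetric]
    by (rule DERIV_sum) (auto intro!: derivative_eq_intros g)
qed

lemma vanishes:
  assumes c: "c = (real CARD('n) + \<theta> - 2) / 2" "c > 0" and \<tau>: "2 + \<tau> > 0" and p: "p > 0"
    and sub: "c * (p - 1) \<le> 2 + \<tau>" and x: "norm x \<ge> 1"
  shows "u x = 0"
proof (rule ccontr)
  assume nz: "u x \<noteq> 0"
  \<comment> \<open>This is \<open>c (p_s - p)\<close>, because
    \<open>c (p_s - 1) = 2 + \<tau>\<close>.\<close>
  define \<alpha> where "\<alpha> = 2 + \<tau> - c * (p - 1)"
  have x': "norm x > 1" "u x > 0" using nz x boundary[of x] nonneg[of x] by (auto simp: less_le)
  define e where "e = x /\<^sub>R norm x"
  have e: "norm e = 1" "norm x *\<^sub>R e = x" using x' by (cases "x = 0"; auto simp: e_def)+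
  have "u (2 *\<^sub>R e) > 0" using x' e by (intro positive_on_ray[of e "norm x" 2]) auto
  then have "K \<noteq> {}" using e by (auto simp: K_def)
  have K1: "norm x = 1" if "x \<in> K" for x using that by (simp add: K_def)
  have "half_cylinder K (cyl c) (cyl1 c) (cyl2 c) (\<lambda>t x. exp (c * t) * sphere_laplacian (exp t *\<^sub>R x)) c \<alpha> p"
  proof
    show "compact K" by (rule compact_K)
    show "K \<noteq> {}" by fact
    show "c > 0" "0 < p" by fact+
    show "0 \<le> \<alpha>" "0 < \<alpha> + c * (p - 1)" using sub \<tau> by (auto simp: \<alpha>_def)
    show "continuous_on ({0..} \<times> K) (\<lambda>(t, x). cyl c t x)"
      unfolding cyl_def case_prod_unfold
      by (intro continuous_intros continuous_on_compose2[OF cont_u]) (auto simp: K1)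
    show "cyl c 0 x = 0" if "x \<in> K" for x using boundary[of x] K1[OF that] by (simp add: cyl_def)
    show "0 < cyl c t x" if "0 < t" "x \<in> K" for t x
      using K_pos[OF that(2), of "exp t"] that by (simp add: cyl_def)
    show "continuous_on ({0<..} \<times> K) (\<lambda>(t, x). cyl1 c t x)"
    proof -
      have "continuous_on {x. norm x > 1} (G i)" "continuous_on {x. norm x > 1} u" for i
        by (auto intro!: continuous_at_imp_continuous_on isCont_G isCont_u)
      then have "continuous_on ({0<..} \<times> K) (\<lambda>z. G i (exp (fst z) *\<^sub>R snd z))"
        "continuous_on ({0<..} \<times> K) (\<lambda>z. u (exp (fst z) *\<^sub>R snd z))" for i
        by - (rule continuous_on_compose2, assumption, auto intro!: continuous_intros simp: K1)+
      then show ?thesis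
        unfolding cyl1_def D1_def case_prod_unfold by (intro continuous_intros)
    qed
    fix t :: real and x assume tx: "t > 0" "x \<in> K"
    note D = radial_derivatives[OF tx(1) K1[OF tx(2)]]
    show "((\<lambda>t. cyl c t x) has_real_derivative cyl1 c t x) (at t)"
      unfolding cyl_def cyl1_def by (auto intro!: derivative_eq_intros D simp: algebra_simps)
    show "((\<lambda>t. cyl1 c t x) has_real_derivative cyl2 c t x) (at t)"
      unfolding cyl1_def cyl2_def
      by (auto intro!: derivative_eq_intros D simp: algebra_simps power2_eq_square)
    show "cyl2 c t x + exp (c * t) * sphere_laplacian (exp t *\<^sub>R x)
        = c\<^sup>2 * cyl c t x - exp (\<alpha> * t) * cyl c t x powr p"
    proof -
      define y where "y = exp t *\<^sub>R x"
      have y: "norm y = exp t" "norm y > 1" using tx K1 by (auto simp: y_def)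
      have "(norm y)\<^sup>2 * (\<Sum>i\<in>UNIV. H i i y) + \<theta> * D1 y
          = (norm y)\<^sup>2 * ((\<Sum>i\<in>UNIV. H i i y) + \<theta> * (\<Sum>i\<in>UNIV. y $ i * G i y) / (norm y)\<^sup>2)"
        using y(2) by (auto simp: D1_def field_simps)
      also have "\<dots> = - ((norm y)\<^sup>2 * norm y powr \<tau> * u y powr p)"
        unfolding pde[OF y(2)] by simp
      also have "(norm y)\<^sup>2 * norm y powr \<tau> = exp ((2 + \<tau>) * t)"
        unfolding y(1) by (simp add: exp_powr_real power2_eq_square algebra_simps flip: exp_add)
      finally have main: "(norm y)\<^sup>2 * (\<Sum>i\<in>UNIV. H i i y) + \<theta> * D1 y = - (exp ((2 + \<tau>) * t) * u y powr p)" .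
      have "exp (\<alpha> * t) * cyl c t x powr p = exp (\<alpha> * t) * (exp (c * t) powr p * u y powr p)"
        unfolding cyl_def y_def[symmetric] by (simp only: powr_mult)
      also have "\<dots> = exp (c * t) * (exp ((2 + \<tau>) * t) * u y powr p)"
      proof -
        have "exp (\<alpha> * t) * exp (c * t) powr p = exp (c * t) * exp ((2 + \<tau>) * t)"
          by (simp add: exp_powr_real \<alpha>_def algebra_simps flip: exp_add)
        then show ?thesis by (simp only: mult.assoc[symmetric])
      qed
      finally have "exp (\<alpha> * t) * cyl c t x powr p = - exp (c * t) * ((norm y)\<^sup>2 * (\<Sum>i\<in>UNIV. H i i y) + \<theta> * D1 y)"
        using main by simp
      \<comment> \<open>This value of \<open>c\<close> removes the first-order term: the total
        coefficient of \<open>D1\<close> is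
        \<open>2 * c + 2 - CARD('n) - \<theta> = 0\<close>.\<close>
      moreover have "\<theta> = 2 * c + 2 - real CARD('n)" using c(1) by simp
      ultimately show ?thesis
        unfolding sphere_laplacian_eq cyl2_def cyl_def y_def[symmetric]
        by (simp add: algebra_simps)
    qed
    fix t' b assume t': "t' > 0" and min: "\<And>z. z \<in> K \<Longrightarrow> cyl c t' x - b * cyl c t x \<le> cyl c t' z - b * cyl c t z"
    show "0 \<le> exp (c * t') * sphere_laplacian (exp t' *\<^sub>R x) - b * (exp (c * t) * sphere_laplacian (exp t *\<^sub>R x))"
      using sphere_laplacian_min[OF tx(1) t' tx(2), of "exp (c * t')" "b * exp (c * t)"] min
      by (simp add: cyl_def mult.assoc)
  qed
  then show False by (rule half_cylinder.contradiction)
qed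

end

section \<open>The divergence form\<close>

lemma partial_derivative_eq:
  assumes "(f has_derivative f') (at x)"
  shows "partial_derivative i f x = f' (axis i 1)"
  using frechet_derivative_at[OF assms] by (simp add: partial_derivative_def)

lemma has_derivative_partials:
  fixes f :: "real^'n::finite \<Rightarrow> real"
  assumes "f differentiable (at x)"
  shows "(f has_derivative (\<lambda>v. \<Sum>i\<in>UNIV. partial_derivative i f x * v $ i)) (at x)"
proof -
  define D where "D = frechet_derivative f (at x)"
  have D: "(f has_derivative D) (at x)"
    using assms by (simp add: D_def frechet_derivative_works)
  have "D v = (\<Sum>i\<in>UNIV. partial_derivative i f x * v $ i)" for v
  proof -
    have "D v = D (\<Sum>i\<in>UNIV. v $ i *\<^sub>R axis i 1)"
      using basis_expansion[of v] by (simp add: scalar_mult_eq_scaleR)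
    also have "\<dots> = (\<Sum>i\<in>UNIV. v $ i * D (axis i 1))"
      using has_derivative_linear[OF D] by (simp add: linear_sum linear_scale)
    finally show ?thesis by (simp add: partial_derivative_def D_def mult.commute)
  qed
  then show ?thesis using D by presburger
qed

text \<open>Product rule, with \<open>\<theta> |x|^(\<theta> - 2) x\<close> as the gradient of the
  weight.\<close>

lemma divergence_weighted_gradient:
  fixes u :: "real^'n::finite \<Rightarrow> real"
  assumes x: "x \<noteq> 0" and u: "\<And>i. partial_derivative i u differentiable (at x)"
  shows "divergence (\<lambda>y. (norm y powr \<theta>) *\<^sub>R gradient u y) x =
    norm x powr \<theta> * ((\<Sum>i\<in>UNIV. partial_derivative i (partial_derivative i u) x)
      + \<theta> * (\<Sum>i\<in>UNIV. x $ i * partial_derivative i u x) / (norm x)\<^sup>2)"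
proof -
  have "partial_derivative i (\<lambda>y. (norm y powr \<theta> *\<^sub>R gradient u y) $ i) x
    = norm x powr \<theta> * (partial_derivative i (partial_derivative i u) x
      + \<theta> * (x $ i * partial_derivative i u x) / (norm x)\<^sup>2)" for i
  proof -
    note u' = has_derivative_partials[OF u[of i]]
    have "((\<lambda>y. (norm y powr \<theta> *\<^sub>R gradient u y) $ i) has_derivative
      (\<lambda>v. norm x powr \<theta> * (\<theta> * (v \<bullet> sgn x) / norm x) * partial_derivative i u x
        + norm x powr \<theta> * (\<Sum>j\<in>UNIV. partial_derivative j (partial_derivative i u) x * v $ j))) (at x)"
      unfolding gradient_def using x
      by (auto intro!: derivative_eq_intros has_derivative_norm u' simp: algebra_simps)
    from partial_derivative_eq[OF this, of i] show ?thesis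
      using x sum_axis_combination[of "\<lambda>j. partial_derivative j (partial_derivative i u) x" 1 i 0 i]
      by (simp add: inner_axis' sgn_div_norm power2_eq_square field_simps)
  qed
  then show ?thesis
    unfolding divergence_def
    by (simp add: sum.distrib distrib_left sum_distrib_left sum_divide_distrib)
qed

section \<open>Regularity of functions that vanish on an open set\<close>

lemma has_derivative_zero_on_open:
  assumes "open U" "\<And>y. y \<in> U \<Longrightarrow> f y = 0" "x \<in> U"
  shows "(f has_derivative (\<lambda>_. 0)) (at x)"
  using has_derivative_transform_within_open[of "\<lambda>_. 0" "\<lambda>_. 0" x UNIV U f] assms by auto

lemma partial_derivative_zero_on_open:
  assumes "open U" "\<And>y. y \<in> U \<Longrightarrow> f y = 0" "x \<in> U"
  shows "partial_derivative i f x = 0"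
  using partial_derivative_eq[OF has_derivative_zero_on_open[OF assms]] .

lemma C1_on_zero:
  assumes "open U" "\<And>y. y \<in> U \<Longrightarrow> f y = 0"
  shows "C1_on U f"
proof -
  have "continuous_on U (partial_derivative i f)" for i
    by (rule continuous_on_eq[OF continuous_on_const[of U 0]])
      (simp add: partial_derivative_zero_on_open[OF assms])
  moreover have "f differentiable (at x)" if "x \<in> U" for x
    using has_derivative_zero_on_open[OF assms that] by (rule differentiableI)
  ultimately show ?thesis by (simp add: C1_on_def)
qed

lemma C2_on_closure_zero:
  assumes U: "open U" and f: "\<And>y. y \<in> closure U \<Longrightarrow> f y = 0"
  shows "C2_on_closure U f"
proof -
  have f': "\<And>y. y \<in> U \<Longrightarrow> f y = 0" using f closure_subset by blast
  have p1: "partial_derivative i f x = 0" if "x \<in> U" for i x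
    using partial_derivative_zero_on_open[of U f] U f' that by blast
  have p2: "partial_derivative j (partial_derivative i f) x = 0" if "x \<in> U" for i j x
    using partial_derivative_zero_on_open[of U "partial_derivative i f"] U p1 that by blast
  \<comment> \<open>All derivatives up to second order vanish in \<open>U\<close>, so the constant 0
    is their continuous extension.\<close>
  have ext: "extends_continuously U g" if "\<And>x. x \<in> U \<Longrightarrow> g x = 0" for g
    unfolding extends_continuously_def using that by (intro exI[of _ "\<lambda>_. 0"]) auto
  have "continuous_on (closure U) f"
    by (rule continuous_on_eq[OF continuous_on_const[of "closure U" 0]]) (simp add: f)
  then show ?thesis
    using C1_on_zero[of U f] C1_on_zero[of U "partial_derivative i f" for i] U f' p1 ext[OF p1] ext[OF p2]
    by (simp add: C2_on_closure_def C2_on_def)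
qed

theorem theorem1p1:
  fixes \<theta> l N' \<tau> p_s p :: real and u :: "real^'n::finite \<Rightarrow> real"
  defines "N' \<equiv> real CARD('n) + \<theta>"
    and "\<tau> \<equiv> l - \<theta>"
    and "p_s \<equiv> (N' + 2 + 2 * \<tau>) / (N' - 2)"
  assumes "N' > 2" and "\<tau> > -2" and "0 < p" and "p \<le> p_s"
  shows "(C2_on_closure (- cball 0 1) u \<and>
          (\<forall>x\<in>- ball 0 1. 0 \<le> u x) \<and>
          (\<forall>x\<in>- cball 0 1.
             - divergence (\<lambda>y. (norm y powr \<theta>) *\<^sub>R gradient u y) x = norm x powr l * u x powr p) \<and>
          (\<forall>x\<in>sphere 0 1. u x = 0))
         \<longleftrightarrow> (\<forall>x\<in>- ball 0 1. u x = 0)"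
    (is "?solution \<longleftrightarrow> ?zero")
proof
  assume ?solution
  then have C2: "C2_on (- cball 0 1) u" and cont: "continuous_on (- ball 0 1) u"
    and nonneg: "\<And>x. x \<in> - ball 0 1 \<Longrightarrow> 0 \<le> u x"
    and pde: "\<And>x. x \<in> - cball 0 1 \<Longrightarrow>
      - divergence (\<lambda>y. (norm y powr \<theta>) *\<^sub>R gradient u y) x = norm x powr l * u x powr p"
    and boundary: "\<And>x. x \<in> sphere 0 1 \<Longrightarrow> u x = 0"
    by (simp_all add: C2_on_closure_def closure_exterior_unit_ball)
  have sol: "exterior_solution u (\<lambda>i. partial_derivative i u)
      (\<lambda>i j. partial_derivative j (partial_derivative i u)) \<theta> \<tau> p"
  proof
    fix x :: "real^'n" assume x: "norm x > 1"
    have diff: "u differentiable (at x)" "\<And>i. partial_derivative i u differentiable (at x)"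
      using C2 x by (auto simp: C2_on_def C1_on_def)
    show "(u has_derivative (\<lambda>v. \<Sum>i\<in>UNIV. partial_derivative i u x * v $ i)) (at x)"
      "(partial_derivative i u has_derivative
        (\<lambda>v. \<Sum>j\<in>UNIV. partial_derivative j (partial_derivative i u) x * v $ j)) (at x)" for i
      by (intro has_derivative_partials diff)+
    have "x \<noteq> 0" using x by auto
    have "norm x powr \<theta> * ((\<Sum>i\<in>UNIV. partial_derivative i (partial_derivative i u) x)
      + \<theta> * (\<Sum>i\<in>UNIV. x $ i * partial_derivative i u x) / (norm x)\<^sup>2) = - (norm x powr l * u x powr p)"
      using pde[of x] x unfolding divergence_weighted_gradient[OF \<open>x \<noteq> 0\<close> diff(2)] by simp
    \<comment> \<open>Splitting \<open>l = \<theta> + \<tau>\<close> exposes the nonzero factor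
      \<open>norm x powr \<theta>\<close>, which then cancels.\<close>
    also have "norm x powr l = norm x powr \<theta> * norm x powr \<tau>"
      unfolding \<tau>_def powr_add[symmetric] by simp
    finally have "norm x powr \<theta> * ((\<Sum>i\<in>UNIV. partial_derivative i (partial_derivative i u) x)
      + \<theta> * (\<Sum>i\<in>UNIV. x $ i * partial_derivative i u x) / (norm x)\<^sup>2)
      = norm x powr \<theta> * - (norm x powr \<tau> * u x powr p)"
      by (simp only: mult_minus_right mult.assoc)
    then show "(\<Sum>i\<in>UNIV. partial_derivative i (partial_derivative i u) x)
      + \<theta> * (\<Sum>i\<in>UNIV. x $ i * partial_derivative i u x) / (norm x)\<^sup>2 = - (norm x powr \<tau> * u x powr p)"
      using \<open>x \<noteq> 0\<close> unfolding mult_cancel_left by simp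
  qed (use cont nonneg boundary in auto)
  show ?zero
  proof
    fix x :: "real^'n" assume "x \<in> - ball 0 1"
    then show "u x = 0"
      using assms
      by (intro exterior_solution.vanishes[OF sol, of "(N' - 2) / 2"]) (auto simp: field_simps)
  qed
next
  assume ?zero
  then have z: "\<And>x. x \<in> - ball 0 1 \<Longrightarrow> u x = 0" by blast
  then have z': "\<And>x. x \<in> - cball 0 1 \<Longrightarrow> u x = 0" by auto
  have U: "open (- cball (0::real^'n) 1)" by auto
  have "divergence (\<lambda>y. (norm y powr \<theta>) *\<^sub>R gradient u y) x = 0" if "x \<in> - cball 0 1" for x
  proof -
    \<comment> \<open>The exterior is open, so the gradient vanishes there, hence also the weighted
      field and its partial derivatives.\<close>
    have "gradient u y = 0" if "y \<in> - cball 0 1" for y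
      using partial_derivative_zero_on_open[of "- cball 0 1" u y] U z' that
      by (simp add: gradient_def vec_eq_iff)
    then show ?thesis
      unfolding divergence_def
      by (intro sum.neutral ballI partial_derivative_zero_on_open[OF U _ that]) simp
  qed
  moreover have "C2_on_closure (- cball 0 1) u"
    using z by (intro C2_on_closure_zero U) (simp add: closure_exterior_unit_ball)
  ultimately show ?solution
    using z z' by auto
qed

end
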